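(* Let $\mathcal{G}$ be a finite connected graph with universal covering tree $\Delta$ and fundamental group $\Gamma$, and let $\mathfrak{M}$ be an abelian group. Then there is an isomorphism of abelian groups $$H_1(\mathcal{G},\mathfrak{M})\cong \mathfrak{D}^\Gamma_0(\partial\Delta,\mathfrak{M}).$$
   Context: Graphs may have loops and multiple edges. Each geometric edge corresponds to two directed edges, $\delta$ and its reverse $\overline\delta\neq\delta$; each directed edge $\delta$ has an initial vertex $o(\delta)$ and a terminal vertex $t(\delta)$, with $o(\overline\delta)=t(\delta)$. $\Delta$ is the universal covering tree of the finite connected graph $\mathcal{G}$. The fundamental group $\Gamma$ of $\mathcal{G}$ is a free group acting on $\Delta$ (by deck transformations), with quotient $\Gamma\backslash\Delta=\mathcal{G}$. The boundary $\partial\Delta$ is the set of equivalence classes of infinite semi-geodesics in $\Delta$ (infinite one-sided edge paths without backtracking), two semi-geodesics being equivalent if they agree except on finitely many edges. For a directed edge $\delta$ of $\Delta$, $\Omega_\delta\subseteq\partial\Delta$ is the set of classes of semi-geodesics with initial edge $\delta$ and initial vertex $o(\delta)$. The sets $\Omega_\delta$ form a basis of clopen sets for a compact totally disconnected topology on $\partial\Delta$, and $\Gamma$ acts on $\partial\Delta$. An $\mathfrak{M}$-valued distribution on $\partial\Delta$ is a finitely additive $\mathfrak{M}$-valued measure $\mu$ defined on the clopen subsets of $\partial\Delta$. $\mathfrak{D}^\Gamma(\partial\Delta,\mathfrak{M})$ is the additive group of all $\Gamma$-invariant $\mathfrak{M}$-valued distributions on $\partial\Delta$, and $\mathfrak{D}^\Gamma_0(\partial\Delta,\mathfrak{M})=\{\mu\in\mathfrak{D}^\Gamma(\partial\Delta,\mathfrak{M}):\mu(\partial\Delta)=0\}$.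 Let $V$ be the vertex set and $E$ the directed edge set of $\mathcal{G}$, and choose an orientation, i.e. a partition $E=E_+\sqcup\overline{E_+}$. Then $H_1(\mathcal{G},\mathfrak{M})=\ker\partial$, where $\partial:\mathfrak{M}E_+\to\mathfrak{M}V$ is the homomorphism determined by $\partial x=t(x)-o(x)$; here $\mathfrak{M}S$ denotes the group of finite formal sums $\sum_{s\in S}n_s s$ with $n_s\in\mathfrak{M}$. *)

theory Defs
  imports
    "Graph_Theory.Graph_Theory"
    "HOL-Algebra.Coset"
    "HOL-Analysis.Function_Topology"
    "HOL-Library.Poly_Mapping"
begin

text \<open>
  A graph with loops and multiple edges, in which every geometric edge gives two directed edges
  \<open>a\<close> and \<open>arev a \<noteq> a\<close>, is a \<^locale>\<open>bidirected_digraph\<close> of the AFP entry Graph_Theory: the arcs are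
  the directed edges, \<open>o = tail\<close>, \<open>t = head\<close>, and \<open>arev\<close> is the edge reversal (it is required to be
  the identity off the arcs). The basic definitions below do not repeat that assumption.
\<close>

definition non_backtracking :: "('e \<Rightarrow> 'e) \<Rightarrow> 'e list \<Rightarrow> bool" where
  "non_backtracking arev w \<longleftrightarrow> successively (\<lambda>a b. b \<noteq> arev a) w"

text \<open>
  The predicate \<open>tree\<close> of Graph_Theory excludes directed cycles and hence the closed walk \<open>[a, arev a]\<close>,
  so it is not the notion needed for graphs with edge reversal.
\<close>

definition reversal_tree :: "('v, 'e) pre_digraph \<Rightarrow> ('e \<Rightarrow> 'e) \<Rightarrow> bool" where
  "reversal_tree T arev \<longleftrightarrow> bidirected_digraph T arev \<and> Digraph_Component.connected T \<and>
     (\<forall>x w. pre_digraph.awalk T x w x \<and> non_backtracking arev w \<longrightarrow> w = [])"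


section \<open>Universal covering tree and fundamental group\<close>

definition covering ::
  "('v, 'e) pre_digraph \<Rightarrow> ('e \<Rightarrow> 'e) \<Rightarrow> ('x, 'd) pre_digraph \<Rightarrow> ('d \<Rightarrow> 'd) \<Rightarrow>
     ('x \<Rightarrow> 'v) \<Rightarrow> ('d \<Rightarrow> 'e) \<Rightarrow> bool" where
  "covering G arev T arevT pV pE \<longleftrightarrow>
     pV ` verts T = verts G \<and> pE ` arcs T \<subseteq> arcs G \<and>
     (\<forall>d\<in>arcs T. tail G (pE d) = pV (tail T d) \<and> head G (pE d) = pV (head T d) \<and>
                 pE (arevT d) = arev (pE d)) \<and>
     (\<forall>x\<in>verts T. bij_betw pE (out_arcs T x) (out_arcs G (pV x)))"

definition universal_covering_tree ::
  "('v, 'e) pre_digraph \<Rightarrow> ('e \<Rightarrow> 'e) \<Rightarrow> ('x, 'd) pre_digraph \<Rightarrow> ('d \<Rightarrow> 'd) \<Rightarrow>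
     ('x \<Rightarrow> 'v) \<Rightarrow> ('d \<Rightarrow> 'e) \<Rightarrow> bool" where
  "universal_covering_tree G arev T arevT pV pE \<longleftrightarrow>
     reversal_tree T arevT \<and> covering G arev T arevT pV pE"

definition closed_walks :: "('v, 'e) pre_digraph \<Rightarrow> 'v \<Rightarrow> 'e list set" where
  "closed_walks G v = {w. pre_digraph.awalk G v w v}"

definition elementary_reductions ::
  "('v, 'e) pre_digraph \<Rightarrow> ('e \<Rightarrow> 'e) \<Rightarrow> 'v \<Rightarrow> ('e list \<times> 'e list) set" where
  "elementary_reductions G arev v =
     {(u @ [a, arev a] @ w, u @ w) | u a w.
        u @ [a, arev a] @ w \<in> closed_walks G v \<and> u @ w \<in> closed_walks G v}"

definition homotopy :: "('v, 'e) pre_digraph \<Rightarrow> ('e \<Rightarrow> 'e) \<Rightarrow> 'v \<Rightarrow> ('e list \<times> 'e list) set" where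
  "homotopy G arev v =
     (elementary_reductions G arev v \<union> (elementary_reductions G arev v)\<inverse>)\<^sup>* \<inter>
     closed_walks G v \<times> closed_walks G v"

definition fundamental_group ::
  "('v, 'e) pre_digraph \<Rightarrow> ('e \<Rightarrow> 'e) \<Rightarrow> 'v \<Rightarrow> 'e list set monoid" where
  "fundamental_group G arev v =
     \<lparr>carrier = closed_walks G v // homotopy G arev v,
      mult = (\<lambda>A B. \<Union>a\<in>A. \<Union>b\<in>B. homotopy G arev v `` {a @ b}),
      one = homotopy G arev v `` {[]}\<rparr>"

text \<open>
  A deck transformation is a pair of a vertex map and an edge map; \<open>permutes\<close> makes both of them
  the identity off the graph, so that equal transformations are equal as pairs of functions.
\<close>

definition deck_transformations ::
  "('x, 'd) pre_digraph \<Rightarrow> ('d \<Rightarrow> 'd) \<Rightarrow> ('x \<Rightarrow> 'v) \<Rightarrow> ('d \<Rightarrow> 'e) \<Rightarrow> (('x \<Rightarrow> 'x) \<times> ('d \<Rightarrow> 'd)) set" where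
  "deck_transformations T arevT pV pE =
     {(gV, gE). gV permutes verts T \<and> gE permutes arcs T \<and>
        (\<forall>d\<in>arcs T. tail T (gE d) = gV (tail T d) \<and> head T (gE d) = gV (head T d) \<and>
                    gE (arevT d) = arevT (gE d) \<and> pE (gE d) = pE d) \<and>
        (\<forall>x\<in>verts T. pV (gV x) = pV x)}"

text \<open>
  The action of the fundamental group based at \<open>pV x0\<close>: a homotopy class \<open>\<gamma>\<close> acts as the deck
  transformation that moves \<open>x0\<close> to the end point of the lift, starting at \<open>x0\<close>, of a loop in \<open>\<gamma>\<close>.
\<close>

definition deck_action ::
  "('x, 'd) pre_digraph \<Rightarrow> ('d \<Rightarrow> 'd) \<Rightarrow> ('x \<Rightarrow> 'v) \<Rightarrow> ('d \<Rightarrow> 'e) \<Rightarrow> 'x \<Rightarrow>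
     'e list set \<Rightarrow> ('x \<Rightarrow> 'x) \<times> ('d \<Rightarrow> 'd)" where
  "deck_action T arevT pV pE x0 \<gamma> =
     (THE g. g \<in> deck_transformations T arevT pV pE \<and>
        (\<exists>w. map pE w \<in> \<gamma> \<and> pre_digraph.awalk T x0 w (fst g x0)))"


section \<open>The boundary of a tree\<close>

definition semi_geodesics :: "('x, 'd) pre_digraph \<Rightarrow> ('d \<Rightarrow> 'd) \<Rightarrow> (nat \<Rightarrow> 'd) set" where
  "semi_geodesics T arevT =
     {r. \<forall>i. r i \<in> arcs T \<and> head T (r i) = tail T (r (Suc i)) \<and> r (Suc i) \<noteq> arevT (r i)}"

text \<open>Agreement except on finitely many edges: the edge sequences coincide, possibly after a shift,
  once finite initial segments are removed.\<close>

definition cofinal :: "('x, 'd) pre_digraph \<Rightarrow> ('d \<Rightarrow> 'd) \<Rightarrow> ((nat \<Rightarrow> 'd) \<times> (nat \<Rightarrow> 'd)) set" where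
  "cofinal T arevT =
     {(r, s). r \<in> semi_geodesics T arevT \<and> s \<in> semi_geodesics T arevT \<and>
        (\<exists>m n. \<forall>k. r (m + k) = s (n + k))}"

definition boundary :: "('x, 'd) pre_digraph \<Rightarrow> ('d \<Rightarrow> 'd) \<Rightarrow> (nat \<Rightarrow> 'd) set set" where
  "boundary T arevT = semi_geodesics T arevT // cofinal T arevT"

definition boundary_cylinder :: "('x, 'd) pre_digraph \<Rightarrow> ('d \<Rightarrow> 'd) \<Rightarrow> 'd \<Rightarrow> (nat \<Rightarrow> 'd) set set" where
  "boundary_cylinder T arevT d = {\<xi> \<in> boundary T arevT. \<exists>r\<in>\<xi>. r 0 = d}"

definition boundary_topology ::
  "('x, 'd) pre_digraph \<Rightarrow> ('d \<Rightarrow> 'd) \<Rightarrow> (nat \<Rightarrow> 'd) set topology" where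
  "boundary_topology T arevT = topology_generated_by (boundary_cylinder T arevT ` arcs T)"

definition boundary_action ::
  "('x, 'd) pre_digraph \<Rightarrow> ('d \<Rightarrow> 'd) \<Rightarrow> ('x \<Rightarrow> 'v) \<Rightarrow> ('d \<Rightarrow> 'e) \<Rightarrow> 'x \<Rightarrow>
     'e list set \<Rightarrow> (nat \<Rightarrow> 'd) set \<Rightarrow> (nat \<Rightarrow> 'd) set" where
  "boundary_action T arevT pV pE x0 \<gamma> \<xi> = (\<lambda>r. snd (deck_action T arevT pV pE x0 \<gamma>) \<circ> r) ` \<xi>"


section \<open>Distributions\<close>

definition clopenin :: "'p topology \<Rightarrow> 'p set \<Rightarrow> bool" where
  "clopenin X U \<longleftrightarrow> openin X U \<and> closedin X U"

text \<open>
  A function on the clopen sets is encoded as a total function that is \<open>0\<close> on all other sets.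
  Finite additivity is stated for two sets; \<open>\<mu> {} = 0\<close> is the case \<open>U = W = {}\<close>.
\<close>

definition distribution :: "'p topology \<Rightarrow> ('p set \<Rightarrow> 'm::ab_group_add) \<Rightarrow> bool" where
  "distribution X \<mu> \<longleftrightarrow>
     (\<forall>U W. clopenin X U \<and> clopenin X W \<and> U \<inter> W = {} \<longrightarrow> \<mu> (U \<union> W) = \<mu> U + \<mu> W) \<and>
     (\<forall>U. \<not> clopenin X U \<longrightarrow> \<mu> U = 0)"

definition invariant_distributions ::
  "('g, 'z) monoid_scheme \<Rightarrow> ('g \<Rightarrow> 'p \<Rightarrow> 'p) \<Rightarrow> 'p topology \<Rightarrow> ('p set \<Rightarrow> 'm::ab_group_add) monoid" where
  "invariant_distributions \<Gamma> act X =
     \<lparr>carrier = {\<mu>. distribution X \<mu> \<and> (\<forall>\<gamma>\<in>carrier \<Gamma>. \<forall>U. clopenin X U \<longrightarrow> \<mu> (act \<gamma> ` U) = \<mu> U)},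
      mult = (\<lambda>\<mu> \<nu> U. \<mu> U + \<nu> U),
      one = (\<lambda>U. 0)\<rparr>"

definition invariant_distributions0 ::
  "('g, 'z) monoid_scheme \<Rightarrow> ('g \<Rightarrow> 'p \<Rightarrow> 'p) \<Rightarrow> 'p topology \<Rightarrow> ('p set \<Rightarrow> 'm::ab_group_add) monoid" where
  "invariant_distributions0 \<Gamma> act X =
     (invariant_distributions \<Gamma> act X)
       \<lparr>carrier := {\<mu> \<in> carrier (invariant_distributions \<Gamma> act X). \<mu> (topspace X) = 0}\<rparr>"


section \<open>Homology\<close>

definition orientation :: "('v, 'e) pre_digraph \<Rightarrow> ('e \<Rightarrow> 'e) \<Rightarrow> 'e set \<Rightarrow> bool" where
  "orientation G arev Ep \<longleftrightarrow> arcs G = Ep \<union> arev ` Ep \<and> Ep \<inter> arev ` Ep = {}"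

definition formal_sums :: "'s set \<Rightarrow> ('s \<Rightarrow>\<^sub>0 'm::ab_group_add) monoid" where
  "formal_sums S = \<lparr>carrier = {c. Poly_Mapping.keys c \<subseteq> S}, mult = (+), one = 0\<rparr>"

definition boundary_hom ::
  "('v, 'e) pre_digraph \<Rightarrow> ('e \<Rightarrow>\<^sub>0 'm) \<Rightarrow> ('v \<Rightarrow>\<^sub>0 'm::ab_group_add)" where
  "boundary_hom G c =
     (\<Sum>a\<in>Poly_Mapping.keys c.
        Poly_Mapping.single (head G a) (Poly_Mapping.lookup c a) -
        Poly_Mapping.single (tail G a) (Poly_Mapping.lookup c a))"

definition H1 :: "('v, 'e) pre_digraph \<Rightarrow> 'e set \<Rightarrow> ('e \<Rightarrow>\<^sub>0 'm::ab_group_add) monoid" where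
  "H1 G Ep = (formal_sums Ep)
     \<lparr>carrier := kernel (formal_sums Ep) (formal_sums (verts G)) (boundary_hom G)\<rparr>"

end

theory Submission
  imports Defs
begin

text \<open>
  For an arc \<open>d\<close> of the tree let \<open>\<Omega>\<^sub>d\<close> be the set of ends that are reached through \<open>d\<close>. Since an end
  is represented by exactly one ray from each vertex, the boundary is the disjoint union of the
  sets \<open>\<Omega>\<^sub>d\<close> over the arcs \<open>d\<close> that leave any fixed vertex (\<open>boundary_eq_Union_out\<close>,
  \<open>cyl_disjoint_out\<close>), and \<open>\<Omega>\<^sub>d\<close> is the disjoint union of the \<open>\<Omega>\<^sub>e\<close> over the arcs \<open>e\<close> that continue
  \<open>d\<close> without backtracking (\<open>cyl_eq_Union_next\<close>). Hence for a distribution \<open>\<nu>\<close> of total mass zero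
  the function \<open>d \<mapsto> \<nu> \<Omega>\<^sub>d\<close> changes sign when \<open>d\<close> is reversed, and its sum over the arcs that leave a
  vertex is zero: it is a flow on the tree (\<open>distribution_imp_flow\<close>).

  Conversely, every flow comes from exactly one such distribution. The boundary is compact, so a
  clopen set is a union of sets \<open>\<Omega>\<^sub>d\<close> with \<open>d\<close> at a fixed sufficiently large distance from a base
  vertex (\<open>clopen_resolved\<close>); its measure has to be the sum of the flow over these arcs, and
  Kirchhoff's law makes the sum independent of the distance (\<open>level_sum_Suc\<close>).

  The fundamental group acts by deck transformations, transitively on the arcs over a given arc of
  the base graph (\<open>deck_action_transitive\<close>). So a distribution is invariant if and only if its flow
  is constant on fibres (\<open>invariant_iff\<close>), which means that it is pulled back from the base graph.
  Finally, an antisymmetric function on the arcs of the base graph is the same as a chain on the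
  positively oriented arcs, and Kirchhoff's law says that the chain is a cycle
  (\<open>lookup_boundary_hom\<close>).
\<close>

section \<open>Walks in trees with edge reversal\<close>

lemma (in bidirected_digraph) awalk_reverse:
  "awalk u w v \<Longrightarrow> awalk v (rev (map arev w)) u"
proof (induction w arbitrary: u)
  case (Cons a w)
  then have "awalk v (rev (map arev w)) (head G a)" "a \<in> arcs G" "tail G a = u"
    by (auto simp: awalk_Cons_iff)
  then show ?case by (auto simp: awalk_simps)
qed (simp add: awalk_Nil_iff)

lemma (in bidirected_digraph) non_backtracking_reverse:
  assumes "non_backtracking arev w"
  shows "non_backtracking arev (rev (map arev w))"
  using assms unfolding non_backtracking_def
  by (auto simp: successively_rev successively_map arev_eq_iff elim!: successively_mono)

lemma (in bidirected_digraph) connected_imp_awalk: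
  assumes "Digraph_Component.connected G" "u \<in> verts G" "v \<in> verts G"
  obtains w where "awalk u w v"
proof -
  have "u \<rightarrow>\<^sup>*\<^bsub>mk_symmetric G\<^esub> v"
    using assms by (auto simp: Digraph_Component.connected_def strongly_connected_def)
  then have "u \<rightarrow>\<^sup>*\<^bsub>G\<^esub> v"
    by (simp add: reachable_mk_symmetric_eq[OF sym_arcs])
  then show thesis
    using that by (auto simp: reachable_awalk)
qed

locale reversal_tree_digraph = bidirected_digraph T arev
  for T :: "('x, 'd) pre_digraph" and arev :: "'d \<Rightarrow> 'd" +
  assumes reversal_tree: "reversal_tree T arev"
begin

lemma walk_exists:
  assumes "x \<in> verts T" "y \<in> verts T"
  obtains w where "awalk x w y"
  using reversal_tree connected_imp_awalk assms unfolding reversal_tree_def by blast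

lemma closed_reduced_walk_Nil:
  "awalk x w x \<Longrightarrow> non_backtracking arev w \<Longrightarrow> w = []"
  using reversal_tree unfolding reversal_tree_def by blast

section \<open>Ends of a tree and their cylinders\<close>

abbreviation rays :: "(nat \<Rightarrow> 'd) set" where
  "rays \<equiv> semi_geodesics T arev"

abbreviation cyl :: "'d \<Rightarrow> (nat \<Rightarrow> 'd) set set" where
  "cyl \<equiv> boundary_cylinder T arev"

definition next_arcs :: "('d \<times> 'd) set" where
  "next_arcs = {(d, e). d \<in> arcs T \<and> e \<in> arcs T \<and> head T d = tail T e \<and> e \<noteq> arev d}"

lemma next_arcs_Image:
  "d \<in> arcs T \<Longrightarrow> next_arcs `` {d} = out_arcs T (head T d) - {arev d}"
  by (auto simp: next_arcs_def)

lemma rays_iff: "r \<in> rays \<longleftrightarrow> (\<forall>i. (r i, r (Suc i)) \<in> next_arcs)"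
  by (auto simp: semi_geodesics_def next_arcs_def)

lemma ray_arc: "r \<in> rays \<Longrightarrow> r i \<in> arcs T"
  by (auto simp: semi_geodesics_def)

lemma equiv_cofinal: "equiv rays (cofinal T arev)"
proof (rule equivI)
  show "refl_on rays (cofinal T arev)"
    by (auto simp: refl_on_def cofinal_def)
  show "cofinal T arev \<subseteq> rays \<times> rays"
    by (auto simp: cofinal_def)
  show "sym (cofinal T arev)"
    unfolding sym_def cofinal_def by (auto; metis)
  show "trans (cofinal T arev)"
  proof (rule transI)
    fix r s t assume "(r, s) \<in> cofinal T arev" "(s, t) \<in> cofinal T arev"
    then obtain m n m' n' where *: "r \<in> rays" "s \<in> rays" "t \<in> rays"
        "\<And>k. r (m + k) = s (n + k)" "\<And>k. s (m' + k) = t (n' + k)"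
      by (auto simp: cofinal_def)
    have "r ((m + m') + k) = t ((n' + n) + k)" for k
      using *(4)[of "m' + k"] *(5)[of "n + k"] by (simp add: ac_simps)
    with * show "(r, t) \<in> cofinal T arev" unfolding cofinal_def by blast
  qed
qed

lemma cofinalI:
  "r \<in> rays \<Longrightarrow> s \<in> rays \<Longrightarrow> (\<And>k. r (m + k) = s (n + k)) \<Longrightarrow> (r, s) \<in> cofinal T arev"
  by (auto simp: cofinal_def)

lemma boundaryE:
  assumes "\<xi> \<in> boundary T arev"
  obtains r where "r \<in> rays" "\<xi> = cofinal T arev `` {r}" "r \<in> \<xi>"
  using assms equiv_cofinal equiv_class_self unfolding boundary_def by (metis quotientE)

lemma end_rays: "\<xi> \<in> boundary T arev \<Longrightarrow> r \<in> \<xi> \<Longrightarrow> r \<in> rays"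
  using equiv_cofinal unfolding boundary_def by (meson in_quotient_imp_subset subsetD)

lemma end_cofinal:
  "\<xi> \<in> boundary T arev \<Longrightarrow> r \<in> \<xi> \<Longrightarrow> s \<in> \<xi> \<Longrightarrow> (r, s) \<in> cofinal T arev"
  unfolding boundary_def by (rule quotient_eq_iff[THEN iffD1, OF equiv_cofinal]) auto

lemma end_closed:
  assumes "\<xi> \<in> boundary T arev" "r \<in> \<xi>" "(r, s) \<in> cofinal T arev"
  shows "s \<in> \<xi>"
  using assms in_quotient_imp_closed[OF equiv_cofinal] unfolding boundary_def by blast

lemma end_of_ray:
  assumes "r \<in> rays"
  shows "cofinal T arev `` {r} \<in> boundary T arev" "r \<in> cofinal T arev `` {r}"
  using assms equiv_class_self[OF equiv_cofinal] by (auto simp: boundary_def quotientI)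

lemma cyl_subset_boundary: "cyl d \<subseteq> boundary T arev"
  by (auto simp: boundary_cylinder_def)

text \<open>
  A ray may be shortened or prolonged at its start without changing its end. These two moves
  are all that is needed to compare cylinders.
\<close>

lemma ray_shift:
  assumes "r \<in> rays"
  shows "(\<lambda>i. r (n + i)) \<in> rays" "(r, \<lambda>i. r (n + i)) \<in> cofinal T arev"
proof -
  show "(\<lambda>i. r (n + i)) \<in> rays"
    using assms by (auto simp: rays_iff)
  then show "(r, \<lambda>i. r (n + i)) \<in> cofinal T arev"
    using assms by (intro cofinalI[of _ _ n 0]) auto
qed

lemma ray_Cons:
  assumes "r \<in> rays" "(d, r 0) \<in> next_arcs"
  shows "case_nat d r \<in> rays" "(r, case_nat d r) \<in> cofinal T arev"
proof -
  show "case_nat d r \<in> rays"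
    using assms by (auto simp: rays_iff split: nat.splits)
  then show "(r, case_nat d r) \<in> cofinal T arev"
    using assms by (intro cofinalI[of _ _ 0 1]) auto
qed

lemma cyl_next_subset:
  assumes "(d, e) \<in> next_arcs"
  shows "cyl e \<subseteq> cyl d"
proof
  fix \<xi> assume "\<xi> \<in> cyl e"
  then obtain r where r: "\<xi> \<in> boundary T arev" "r \<in> \<xi>" "r 0 = e"
    by (auto simp: boundary_cylinder_def)
  then have "case_nat d r \<in> \<xi>"
    using assms end_closed end_rays ray_Cons(2) by blast
  then show "\<xi> \<in> cyl d"
    using r(1) unfolding boundary_cylinder_def by (auto intro!: bexI[of _ "case_nat d r"])
qed

lemma cyl_shift:
  assumes "\<xi> \<in> boundary T arev" "r \<in> \<xi>"
  shows "\<xi> \<in> cyl (r n)"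
proof -
  have "(\<lambda>i. r (n + i)) \<in> \<xi>"
    using assms end_closed end_rays ray_shift(2) by blast
  then show ?thesis
    using assms(1) unfolding boundary_cylinder_def by (auto intro!: bexI[of _ "\<lambda>i. r (n + i)"])
qed

lemma cyl_ray_antimono:
  assumes "r \<in> rays"
  shows "cyl (r (m + n)) \<subseteq> cyl (r m)"
proof (induction n)
  case (Suc n)
  have "(r (m + n), r (m + Suc n)) \<in> next_arcs"
    using assms by (auto simp: rays_iff)
  with Suc show ?case
    using cyl_next_subset by blast
qed auto

lemma cyl_eq_Union_next:
  assumes "d \<in> arcs T"
  shows "cyl d = (\<Union>e\<in>next_arcs `` {d}. cyl e)"
proof
  show "cyl d \<subseteq> (\<Union>e\<in>next_arcs `` {d}. cyl e)"
  proof
    fix \<xi> assume "\<xi> \<in> cyl d"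
    then obtain r where r: "\<xi> \<in> boundary T arev" "r \<in> \<xi>" "r 0 = d"
      by (auto simp: boundary_cylinder_def)
    then have "(d, r 1) \<in> next_arcs"
      using end_rays[OF r(1,2)] by (auto simp: rays_iff)
    then show "\<xi> \<in> (\<Union>e\<in>next_arcs `` {d}. cyl e)"
      using cyl_shift[OF r(1,2), of 1] by auto
  qed
qed (use cyl_next_subset in auto)

text \<open>
  A representing ray can be transported to any starting vertex along a walk, one arc at a time:
  either the arc can be put in front of the ray, or the ray begins with the reverse of the arc
  and then its first step is dropped.
\<close>

lemma exists_ray_from:
  assumes \<xi>: "\<xi> \<in> boundary T arev" and "x \<in> verts T"
  shows "\<exists>r\<in>\<xi>. tail T (r 0) = x"
proof -
  from \<xi> obtain s where s: "s \<in> \<xi>" by (auto elim: boundaryE)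
  then have "tail T (s 0) \<in> verts T"
    using end_rays[OF \<xi>] ray_arc by auto
  with \<open>x \<in> verts T\<close> obtain w where "awalk x w (tail T (s 0))"
    using walk_exists by blast
  then show ?thesis
  proof (induction w arbitrary: x)
    case Nil
    with s show ?case by (auto simp: awalk_simps)
  next
    case (Cons a w)
    then have a: "a \<in> arcs T" "tail T a = x" and "awalk (head T a) w (tail T (s 0))"
      by (auto simp: awalk_simps)
    with Cons.IH obtain r where r: "r \<in> \<xi>" "tail T (r 0) = head T a" by blast
    have ray: "r \<in> rays" using end_rays \<xi> r by blast
    show ?case
    proof (cases "r 0 = arev a")
      case True
      have "(\<lambda>i. r (1 + i)) \<in> \<xi>"
        using ray_shift(2)[OF ray] \<xi> r end_closed by blast
      moreover have "tail T (r (1 + 0)) = x"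
        using ray True a by (auto simp: semi_geodesics_def dest: spec[of _ 0])
      ultimately show ?thesis by force
    next
      case False
      then have "(a, r 0) \<in> next_arcs"
        using a r ray ray_arc by (auto simp: next_arcs_def)
      then have "case_nat a r \<in> \<xi>"
        using ray_Cons(2)[OF ray] \<xi> r end_closed by blast
      with a show ?thesis by (auto intro!: bexI[of _ "case_nat a r"])
    qed
  qed
qed

lemma ray_prefix_walk:
  assumes "r \<in> rays"
  shows "awalk (tail T (r 0)) (map r [0..<m]) (tail T (r m))"
    and "non_backtracking arev (map r [0..<m])"
proof -
  show "awalk (tail T (r 0)) (map r [0..<m]) (tail T (r m))"
  proof (induction m)
    case 0 then show ?case using ray_arc[OF assms, of 0] by (auto simp: awalk_simps)
  next
    case (Suc m)
    then show ?case
      using assms ray_arc[OF assms, of m] by (auto simp: awalk_simps semi_geodesics_def)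
  qed
  show "non_backtracking arev (map r [0..<m])"
    using assms unfolding non_backtracking_def
    by (auto simp: successively_conv_nth semi_geodesics_def)
qed

text \<open>
  This is where the absence of cycles enters. If two rays left the same vertex by different
  arcs and met again, running back along one of them and then out along the other would be a
  closed walk without backtracking.
\<close>

lemma cofinal_rays_same_first_arc:
  assumes "(r, s) \<in> cofinal T arev" "tail T (r 0) = tail T (s 0)"
  shows "r 0 = s 0"
proof (rule ccontr)
  assume neq: "r 0 \<noteq> s 0"
  from assms(1) obtain m n where rs: "r \<in> rays" "s \<in> rays" "\<And>k. r (m + k) = s (n + k)"
    by (auto simp: cofinal_def)
  let ?w = "rev (map arev (map s [0..<n])) @ map r [0..<m]"
  have "awalk (tail T (s n)) (rev (map arev (map s [0..<n]))) (tail T (r 0))"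
    using awalk_reverse[OF ray_prefix_walk(1)[OF rs(2), of n]] assms(2) by simp
  then have "awalk (tail T (s n)) ?w (tail T (s n))"
    using ray_prefix_walk(1)[OF rs(1), of m] rs(3)[of 0] awalk_appendI by auto
  moreover have "non_backtracking arev ?w"
  proof -
    have "non_backtracking arev (rev (map arev (map s [0..<n])))"
      by (rule non_backtracking_reverse) (rule ray_prefix_walk(2)[OF rs(2)])
    moreover have "n \<noteq> 0 \<Longrightarrow> last (rev (map arev (map s [0..<n]))) = arev (s 0)"
      by (auto simp: last_rev hd_map)
    moreover have "m \<noteq> 0 \<Longrightarrow> hd (map r [0..<m]) = r 0"
      by (auto simp: hd_map)
    ultimately show ?thesis
      using ray_prefix_walk(2)[OF rs(1), of m] neq
      unfolding non_backtracking_def successively_append_iff by (cases "n = 0"; cases "m = 0") auto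
  qed
  ultimately have "?w = []" by (rule closed_reduced_walk_Nil)
  then have "m = 0" "n = 0" by auto
  with rs(3)[of 0] neq show False by simp
qed

lemma cyl_disjoint_out:
  assumes "tail T d = tail T e" "d \<noteq> e"
  shows "cyl d \<inter> cyl e = {}"
proof (rule ccontr)
  assume "cyl d \<inter> cyl e \<noteq> {}"
  then obtain \<xi> r s where "\<xi> \<in> boundary T arev" "r \<in> \<xi>" "s \<in> \<xi>" "r 0 = d" "s 0 = e"
    by (auto simp: boundary_cylinder_def)
  with assms show False
    using end_cofinal cofinal_rays_same_first_arc by metis
qed

lemma boundary_eq_Union_out:
  assumes "x \<in> verts T"
  shows "boundary T arev = (\<Union>d\<in>out_arcs T x. cyl d)"
proof
  show "boundary T arev \<subseteq> (\<Union>d\<in>out_arcs T x. cyl d)"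
  proof
    fix \<xi> assume \<xi>: "\<xi> \<in> boundary T arev"
    then obtain r where "r \<in> \<xi>" "tail T (r 0) = x" using exists_ray_from assms by blast
    with \<xi> show "\<xi> \<in> (\<Union>d\<in>out_arcs T x. cyl d)"
      using end_rays ray_arc by (auto simp: boundary_cylinder_def)
  qed
qed (use cyl_subset_boundary in auto)

text \<open>
  The ends that lie behind \<open>d\<close>: seen from the tail of \<open>d\<close> they are reached through one of the
  other arcs there, and these are the continuations of \<open>arev d\<close>.
\<close>

lemma cyl_arev:
  assumes "d \<in> arcs T"
  shows "cyl (arev d) = boundary T arev - cyl d"
proof -
  let ?O = "out_arcs T (tail T d)"
  have "cyl (arev d) = (\<Union>e\<in>?O - {d}. cyl e)"
    using cyl_eq_Union_next[of "arev d"] assms by (simp add: next_arcs_Image)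
  moreover have "boundary T arev = (\<Union>e\<in>?O. cyl e)"
    using assms by (intro boundary_eq_Union_out) auto
  moreover have "cyl e \<inter> cyl d = {}" if "e \<in> ?O - {d}" for e
    using that by (intro cyl_disjoint_out) auto
  ultimately show ?thesis using assms by (auto simp del: in_out_arcs_conv)
qed

section \<open>Levels of arcs below a vertex\<close>

text \<open>
  The arcs at distance \<open>n\<close> from \<open>x\<close> that point away from \<open>x\<close>. Their cylinders are the finer and
  finer partitions of the boundary on which measures are computed.
\<close>

definition level :: "'x \<Rightarrow> nat \<Rightarrow> 'd set" where
  "level x n = (next_arcs ^^ n) `` out_arcs T x"

lemma level_0 [simp]: "level x 0 = out_arcs T x"
  by (simp add: level_def)

lemma level_Suc: "level x (Suc n) = next_arcs `` level x n"
  by (auto simp: level_def)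

lemma level_arcs: "d \<in> level x n \<Longrightarrow> d \<in> arcs T"
  by (cases n) (auto simp: level_Suc next_arcs_def)

lemma level_cover:
  assumes "x \<in> verts T"
  shows "boundary T arev = (\<Union>d\<in>level x n. cyl d)"
proof (induction n)
  case (Suc n)
  have "(\<Union>d\<in>level x (Suc n). cyl d) = (\<Union>d\<in>level x n. \<Union>e\<in>next_arcs `` {d}. cyl e)"
    by (auto simp: level_Suc)
  also have "\<dots> = (\<Union>d\<in>level x n. cyl d)"
    using level_arcs cyl_eq_Union_next by (intro SUP_cong) auto
  finally show ?case using Suc by simp
qed (simp add: boundary_eq_Union_out[OF assms])

lemma level_disjoint: "disjoint_family_on cyl (level x n)"
proof (induction n)
  case 0
  show ?case
    unfolding disjoint_family_on_def by (intro ballI impI cyl_disjoint_out) auto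
next
  case (Suc n)
  show ?case
  proof (unfold disjoint_family_on_def, intro ballI impI)
    fix d e assume "d \<in> level x (Suc n)" "e \<in> level x (Suc n)" "d \<noteq> e"
    then obtain d' e' where *: "d' \<in> level x n" "e' \<in> level x n"
        "(d', d) \<in> next_arcs" "(e', e) \<in> next_arcs"
      by (auto simp: level_Suc)
    show "cyl d \<inter> cyl e = {}"
    proof (cases "d' = e'")
      case True
      with * \<open>d \<noteq> e\<close> show ?thesis by (intro cyl_disjoint_out) (auto simp: next_arcs_def)
    next
      case False
      with * Suc have "cyl d' \<inter> cyl e' = {}" by (auto simp: disjoint_family_on_def)
      with * show ?thesis using cyl_next_subset by blast
    qed
  qed
qed

text \<open>
  Levels contain only arcs that point away from \<open>x\<close>. By connectedness every arc points either
  away from \<open>x\<close> or towards it, so reversal reaches the remaining ones.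
\<close>

lemma arc_or_reverse_in_level:
  assumes "x \<in> verts T" "d \<in> arcs T"
  shows "\<exists>n. d \<in> level x n \<or> arev d \<in> level x n"
proof -
  have extend: "\<exists>n. a \<in> level x n \<or> arev a \<in> level x n"
    if "y = x \<or> (\<exists>n. \<exists>e\<in>level x n. head T e = y)" "a \<in> arcs T" "tail T a = y" for y a
  proof -
    from that consider "a \<in> level x 0" | n e where "e \<in> level x n" "head T e = y" by auto
    then show ?thesis
    proof cases
      case 2
      show ?thesis
      proof (cases "a = arev e")
        case False
        with 2 that have "a \<in> level x (Suc n)"
          using level_arcs by (auto simp: level_Suc next_arcs_def)
        then show ?thesis by blast
      qed (use 2 in auto)
    qed blast
  qed
  have reach: "y = x \<or> (\<exists>n. \<exists>e\<in>level x n. head T e = y)" if "awalk x w y" for w y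
    using that
  proof (induction w arbitrary: y rule: rev_induct)
    case (snoc a w)
    then have a: "awalk x w (tail T a)" "a \<in> arcs T" "head T a = y" by (auto simp: awalk_simps)
    with snoc.IH extend obtain n where "a \<in> level x n \<or> arev a \<in> level x n" by blast
    then show ?case
    proof
      assume r: "arev a \<in> level x n"
      show ?thesis
      proof (cases n)
        case 0
        with r a show ?thesis by auto
      next
        case (Suc m)
        with r obtain e where "e \<in> level x m" "(e, arev a) \<in> next_arcs" by (auto simp: level_Suc)
        with a show ?thesis by (auto simp: next_arcs_def)
      qed
    qed (use a in auto)
  qed (auto simp: awalk_simps)
  from assms obtain w where "awalk x w (tail T d)" using walk_exists by (meson tail_in_verts)
  from reach[OF this] assms extend show ?thesis by blast
qed

end

section \<open>Finite additivity of distributions\<close>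

lemma clopenin_Un: "clopenin X U \<Longrightarrow> clopenin X W \<Longrightarrow> clopenin X (U \<union> W)"
  by (auto simp: clopenin_def)

lemma clopenin_empty: "clopenin X {}"
  by (auto simp: clopenin_def)

lemma distribution_empty:
  assumes "distribution X \<nu>"
  shows "\<nu> {} = 0"
proof -
  have "\<nu> ({} \<union> {}) = \<nu> {} + \<nu> {}"
    using assms clopenin_empty unfolding distribution_def by blast
  then show ?thesis by simp
qed

lemma distribution_Union:
  assumes "distribution X \<nu>" "finite D" "\<And>d. d \<in> D \<Longrightarrow> clopenin X (A d)" "disjoint_family_on A D"
  shows "clopenin X (\<Union>d\<in>D. A d) \<and> \<nu> (\<Union>d\<in>D. A d) = (\<Sum>d\<in>D. \<nu> (A d))"
  using assms(2-)
proof (induction D)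
  case (insert a D)
  then have IH: "clopenin X (\<Union>d\<in>D. A d)" "\<nu> (\<Union>d\<in>D. A d) = (\<Sum>d\<in>D. \<nu> (A d))"
    by (auto simp: disjoint_family_on_def)
  have "A a \<inter> (\<Union>d\<in>D. A d) = {}"
    using insert by (auto simp: disjoint_family_on_def)
  moreover have "clopenin X (A a)" using insert by auto
  ultimately have "\<nu> (A a \<union> (\<Union>d\<in>D. A d)) = \<nu> (A a) + \<nu> (\<Union>d\<in>D. A d)"
    using assms(1) IH(1) unfolding distribution_def by blast
  with IH \<open>clopenin X (A a)\<close> insert show ?case by (auto intro: clopenin_Un)
qed (use assms(1) in \<open>auto simp: clopenin_empty distribution_empty\<close>)

section \<open>The topology on the ends of a locally finite tree\<close>

locale locally_finite_reversal_tree = reversal_tree_digraph T arev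
  for T :: "('x, 'd) pre_digraph" and arev :: "'d \<Rightarrow> 'd" +
  assumes finite_out_arcs: "finite (out_arcs T x)"
begin

abbreviation ends :: "(nat \<Rightarrow> 'd) set topology" where
  "ends \<equiv> boundary_topology T arev"

lemma topspace_ends: "topspace ends = boundary T arev"
proof -
  have "\<xi> \<in> (\<Union>d\<in>arcs T. cyl d)" if \<xi>: "\<xi> \<in> boundary T arev" for \<xi>
  proof -
    obtain r where "r \<in> rays" "r \<in> \<xi>" using \<xi> by (rule boundaryE)
    then show ?thesis using cyl_shift[OF \<xi>] ray_arc by blast
  qed
  then show ?thesis
    using cyl_subset_boundary by (auto simp: boundary_topology_def topology_generated_by_topspace)
qed

lemma clopenin_cyl:
  assumes "d \<in> arcs T"
  shows "clopenin ends (cyl d)"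
proof -
  have "openin ends (cyl e)" if "e \<in> arcs T" for e
    unfolding boundary_topology_def using that by (intro topology_generated_by_Basis) auto
  from this[OF assms] this[of "arev d"] show ?thesis
    using assms cyl_subset_boundary
    by (simp add: clopenin_def closedin_def topspace_ends cyl_arev)
qed

lemma clopenin_boundary: "clopenin ends (boundary T arev)"
  by (auto simp: clopenin_def simp flip: topspace_ends)

text \<open>
  The cylinders only form a subbasis by definition. Along a ray they are nested, so finitely many
  of them can be replaced by one: the cylinders along a ray are a neighbourhood basis of its end.
\<close>

lemma open_contains_ray_cylinder:
  assumes "openin ends U" "\<xi> \<in> U" "r \<in> \<xi>"
  shows "\<exists>n. cyl (r n) \<subseteq> U"
proof -
  have \<xi>: "\<xi> \<in> boundary T arev"
    using assms openin_subset topspace_ends by blast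
  have ray: "r \<in> rays" using end_rays \<xi> assms by blast
  have "generate_topology_on (cyl ` arcs T) U"
    using assms(1) unfolding boundary_topology_def by (rule openin_topology_generated_by)
  then show ?thesis
    using assms(2)
  proof (induction rule: generate_topology_on.induct)
    case (Int A B)
    then obtain m n where "cyl (r m) \<subseteq> A" "cyl (r n) \<subseteq> B" by auto
    moreover have "cyl (r (m + n)) \<subseteq> cyl (r m)" "cyl (r (m + n)) \<subseteq> cyl (r n)"
      using cyl_ray_antimono[OF ray, of m n] cyl_ray_antimono[OF ray, of n m]
      by (simp_all add: add.commute)
    ultimately show ?case by blast
  next
    case (UN K)
    then show ?case by blast
  next
    case (Basis A)
    then obtain s where s: "s \<in> \<xi>" "A = cyl (s 0)" by (auto simp: boundary_cylinder_def)
    then obtain m n where "\<And>k. r (m + k) = s (n + k)"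
      using end_cofinal[OF \<xi> \<open>r \<in> \<xi>\<close>] by (force simp: cofinal_def)
    from this[of 0] have "cyl (r m) \<subseteq> A"
      using cyl_ray_antimono[OF end_rays[OF \<xi> s(1)], of 0 n] s by simp
    then show ?case by blast
  qed auto
qed

text \<open>
  As the cylinders of a level cover the boundary, this makes \<open>U\<close> a union of some of them, and the
  same then holds at every later level.
\<close>

definition resolves :: "'x \<Rightarrow> nat \<Rightarrow> (nat \<Rightarrow> 'd) set set \<Rightarrow> bool" where
  "resolves x n U \<longleftrightarrow> (\<forall>d\<in>level x n. cyl d \<subseteq> U \<or> cyl d \<inter> U = {})"

lemma finite_next: "d \<in> arcs T \<Longrightarrow> finite (next_arcs `` {d})"
  by (simp add: next_arcs_Image finite_out_arcs)

lemma finite_level: "finite (level x n)"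
proof (induction n)
  case (Suc n)
  have "level x (Suc n) = (\<Union>d\<in>level x n. next_arcs `` {d})" by (auto simp: level_Suc)
  then show ?case using Suc finite_next level_arcs by auto
qed (simp add: finite_out_arcs)

text \<open>
  This is the compactness of the boundary, in the form of Koenig's lemma. If no level resolved
  \<open>U\<close>, finiteness of the branching would yield a ray such that \<open>U\<close> cuts cylinders at every depth
  below each of its arcs; but the end of that ray has a neighbourhood inside \<open>U\<close> or inside its complement.
\<close>

lemma clopen_resolved:
  assumes U: "clopenin ends U"
  obtains n where "resolves x n U"
proof -
  define unmixed where "unmixed d \<longleftrightarrow> cyl d \<subseteq> U \<or> cyl d \<inter> U = {}" for d
  define fine where "fine A \<longleftrightarrow> (\<exists>n. \<forall>e\<in>(next_arcs ^^ n) `` A. unmixed e)" for A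
  have unmixed_below: "unmixed e" if "(d, e) \<in> next_arcs ^^ n" "unmixed d" for n d e
    using that
  proof (induction n arbitrary: e)
    case (Suc n)
    then show ?case using cyl_next_subset unfolding unmixed_def by fastforce
  qed auto
  \<comment> \<open>Finitely many depths have a common bound, and unmixed cylinders stay unmixed below.\<close>
  have fine_pointwise: "fine A" if "finite A" and "\<And>d. d \<in> A \<Longrightarrow> fine {d}" for A
  proof -
    have "\<forall>d\<in>A. \<exists>n. \<forall>e. (d, e) \<in> next_arcs ^^ n \<longrightarrow> unmixed e"
      using that(2) unfolding fine_def by blast
    then obtain k where k: "\<And>d e. d \<in> A \<Longrightarrow> (d, e) \<in> next_arcs ^^ k d \<Longrightarrow> unmixed e"
      unfolding bchoice_iff by blast
    have "unmixed e" if "d \<in> A" "(d, e) \<in> next_arcs ^^ Max (k ` A)" for d e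
    proof -
      have "k d \<le> Max (k ` A)" using \<open>finite A\<close> that by auto
      then have "(d, e) \<in> next_arcs ^^ (k d + (Max (k ` A) - k d))" using that by simp
      then obtain c where "(d, c) \<in> next_arcs ^^ k d" "(c, e) \<in> next_arcs ^^ (Max (k ` A) - k d)"
        unfolding relpow_add by blast
      with k that unmixed_below show ?thesis by blast
    qed
    then show "fine A" unfolding fine_def by blast
  qed
  have fine_up: "fine {d}" if "fine (next_arcs `` {d})" for d
  proof -
    from that obtain n where "\<forall>e\<in>(next_arcs ^^ n) `` (next_arcs `` {d}). unmixed e"
      unfolding fine_def by blast
    moreover have "\<exists>c. (d, c) \<in> next_arcs \<and> (c, e) \<in> next_arcs ^^ n"
      if "(d, e) \<in> next_arcs ^^ Suc n" for e
      using that by (rule relpow_Suc_D2)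
    ultimately have "\<forall>e\<in>(next_arcs ^^ Suc n) `` {d}. unmixed e"
      by (meson Image_singleton_iff ImageI)
    then show ?thesis unfolding fine_def by blast
  qed
  have "fine (out_arcs T x)"
  proof (rule ccontr)
    assume "\<not> fine (out_arcs T x)"
    then obtain d where d: "d \<in> arcs T" "\<not> fine {d}"
      using fine_pointwise[OF finite_out_arcs] by auto
    have "\<exists>r. \<forall>n. (r n \<in> arcs T \<and> \<not> fine {r n}) \<and> (r n, r (Suc n)) \<in> next_arcs"
    proof (rule dependent_nat_choice)
      fix d n assume "d \<in> arcs T \<and> \<not> fine {d}"
      then have "\<not> fine (next_arcs `` {d})" "finite (next_arcs `` {d})"
        using fine_up finite_next by auto
      then obtain e where "(d, e) \<in> next_arcs" "\<not> fine {e}"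
        using fine_pointwise by blast
      then show "\<exists>e. (e \<in> arcs T \<and> \<not> fine {e}) \<and> (d, e) \<in> next_arcs"
        by (auto simp: next_arcs_def)
    qed (use d in blast)
    then obtain r where r: "\<And>n. \<not> fine {r n}" "\<And>n. (r n, r (Suc n)) \<in> next_arcs" by blast
    let ?\<xi> = "cofinal T arev `` {r}"
    have "r \<in> rays" using r by (auto simp: rays_iff)
    then have \<xi>: "?\<xi> \<in> boundary T arev" "r \<in> ?\<xi>" by (rule end_of_ray)+
    have "openin ends U" "openin ends (boundary T arev - U)"
      using U by (auto simp: clopenin_def closedin_def topspace_ends)
    then obtain n where "cyl (r n) \<subseteq> U \<or> cyl (r n) \<subseteq> boundary T arev - U"
      using \<xi> open_contains_ray_cylinder by (metis DiffI)
    then have "\<forall>e\<in>(next_arcs ^^ 0) `` {r n}. unmixed e" by (auto simp: unmixed_def)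
    with r(1) show False unfolding fine_def by blast
  qed
  then show thesis
    using that unfolding fine_def resolves_def level_def unmixed_def by blast
qed

lemma resolves_Suc:
  assumes "resolves x n U"
  shows "resolves x (Suc n) U"
  unfolding resolves_def
proof
  fix e assume "e \<in> level x (Suc n)"
  then obtain d where "d \<in> level x n" "(d, e) \<in> next_arcs" by (auto simp: level_Suc)
  with assms cyl_next_subset[of d e] show "cyl e \<subseteq> U \<or> cyl e \<inter> U = {}"
    unfolding resolves_def by blast
qed

lemma resolves_mono: "m \<le> n \<Longrightarrow> resolves x m U \<Longrightarrow> resolves x n U"
  by (induction n rule: dec_induct) (assumption, blast intro: resolves_Suc)

lemma Union_resolved:
  assumes "x \<in> verts T" "U \<subseteq> boundary T arev" "resolves x n U"
  shows "U = (\<Union>d\<in>{d \<in> level x n. cyl d \<subseteq> U}. cyl d)"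
proof
  show "U \<subseteq> (\<Union>d\<in>{d \<in> level x n. cyl d \<subseteq> U}. cyl d)"
  proof
    fix \<xi> assume "\<xi> \<in> U"
    moreover from this obtain d where "d \<in> level x n" "\<xi> \<in> cyl d"
      using assms(2) level_cover[OF assms(1)] by blast
    ultimately show "\<xi> \<in> (\<Union>d\<in>{d \<in> level x n. cyl d \<subseteq> U}. cyl d)"
      using assms(3) unfolding resolves_def by blast
  qed
qed blast

text \<open>
  A distribution is therefore determined by its values on cylinders.
\<close>

lemma clopen_cylinder_partition:
  assumes "clopenin ends U"
  obtains D where "finite D" "D \<subseteq> arcs T" "disjoint_family_on cyl D" "U = (\<Union>d\<in>D. cyl d)"
proof -
  obtain x where x: "x \<in> verts T"
    using reversal_tree
    by (auto simp: reversal_tree_def Digraph_Component.connected_def strongly_connected_def)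
  obtain n where "resolves x n U" using clopen_resolved assms by blast
  moreover have "U \<subseteq> boundary T arev"
    using assms topspace_ends by (auto simp: clopenin_def dest: openin_subset)
  ultimately have "U = (\<Union>d\<in>{d \<in> level x n. cyl d \<subseteq> U}. cyl d)"
    using Union_resolved x by blast
  then show thesis
    using finite_level level_arcs level_disjoint[of x n]
    by (intro that[of "{d \<in> level x n. cyl d \<subseteq> U}"]) (auto simp: disjoint_family_on_def)
qed

lemma distribution_eqI:
  assumes "distribution ends \<nu>" "distribution ends \<nu>'" "\<And>d. d \<in> arcs T \<Longrightarrow> \<nu> (cyl d) = \<nu>' (cyl d)"
  shows "\<nu> = \<nu>'"
proof
  fix U
  show "\<nu> U = \<nu>' U"
  proof (cases "clopenin ends U")
    case True
    then obtain D where D: "finite D" "D \<subseteq> arcs T" "disjoint_family_on cyl D" "U = (\<Union>d\<in>D. cyl d)"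
      by (rule clopen_cylinder_partition)
    have "\<nu> U = (\<Sum>d\<in>D. \<nu> (cyl d))" "\<nu>' U = (\<Sum>d\<in>D. \<nu>' (cyl d))"
      using D clopenin_cyl distribution_Union[OF assms(1), of D cyl]
        distribution_Union[OF assms(2), of D cyl] by auto
    with assms(3) D show ?thesis by (auto intro: sum.cong)
  qed (use assms in \<open>auto simp: distribution_def\<close>)
qed

section \<open>Distributions of total mass zero are flows\<close>

text \<open>
  Antisymmetric functions on arcs that satisfy Kirchhoff's law at every vertex.
\<close>

definition flow :: "('d \<Rightarrow> 'm::ab_group_add) \<Rightarrow> bool" where
  "flow f \<longleftrightarrow> (\<forall>d\<in>arcs T. f (arev d) = - f d) \<and> (\<forall>x\<in>verts T. (\<Sum>d\<in>out_arcs T x. f d) = 0)"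

text \<open>
  Kirchhoff's law holds at \<open>x\<close> because the arcs leaving \<open>x\<close> partition the boundary, which has
  mass zero; antisymmetry is the same statement for the partition by an arc and its reverse.
\<close>

lemma distribution_imp_flow:
  assumes \<nu>: "distribution ends \<nu>" and "\<nu> (boundary T arev) = 0"
  shows "flow (\<lambda>d. \<nu> (cyl d))"
  unfolding flow_def
proof (intro conjI ballI)
  fix d assume d: "d \<in> arcs T"
  then have "boundary T arev = cyl d \<union> cyl (arev d)" "cyl d \<inter> cyl (arev d) = {}"
    using cyl_arev cyl_subset_boundary by blast+
  then have "0 = \<nu> (cyl d) + \<nu> (cyl (arev d))"
    using assms d clopenin_cyl unfolding distribution_def by (metis arev_in_arcs)
  then show "\<nu> (cyl (arev d)) = - \<nu> (cyl d)"
    by (metis add.commute eq_neg_iff_add_eq_0)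
next
  fix x assume "x \<in> verts T"
  then show "(\<Sum>d\<in>out_arcs T x. \<nu> (cyl d)) = 0"
    using assms(2) distribution_Union[OF \<nu> finite_out_arcs, of x cyl] clopenin_cyl
      level_disjoint[of x 0] boundary_eq_Union_out by auto
qed

lemma flow_next:
  assumes "flow f" "d \<in> arcs T"
  shows "(\<Sum>e\<in>next_arcs `` {d}. f e) = f d"
proof -
  have "arev d \<in> out_arcs T (head T d)" using assms by auto
  then have "(\<Sum>e\<in>out_arcs T (head T d). f e) = f (arev d) + (\<Sum>e\<in>next_arcs `` {d}. f e)"
    using assms(2) finite_out_arcs by (simp add: next_arcs_Image sum.remove)
  with assms show ?thesis unfolding flow_def by simp
qed

text \<open>
  Branches of the tree without ends occur when the base graph has dead ends. A flow vanishes on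
  them: by Kirchhoff's law a nonzero value can be followed arc by arc, which traces out a ray.
\<close>

lemma flow_dead:
  assumes "flow f" "d \<in> arcs T" "cyl d = {}"
  shows "f d = 0"
proof (rule ccontr)
  assume "f d \<noteq> 0"
  have "\<exists>r. \<forall>n. (r n \<in> arcs T \<and> f (r n) \<noteq> 0 \<and> (n = 0 \<longrightarrow> r n = d)) \<and> (r n, r (Suc n)) \<in> next_arcs"
  proof (rule dependent_nat_choice)
    fix a n assume "a \<in> arcs T \<and> f a \<noteq> 0 \<and> (n = (0::nat) \<longrightarrow> a = d)"
    then have "(\<Sum>e\<in>next_arcs `` {a}. f e) \<noteq> 0" using flow_next assms(1) by metis
    then obtain e where "(a, e) \<in> next_arcs" "f e \<noteq> 0" by (metis Image_singleton_iff sum.neutral)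
    then show "\<exists>e. (e \<in> arcs T \<and> f e \<noteq> 0 \<and> (Suc n = 0 \<longrightarrow> e = d)) \<and> (a, e) \<in> next_arcs"
      by (auto simp: next_arcs_def)
  qed (use assms \<open>f d \<noteq> 0\<close> in blast)
  then obtain r where "r 0 = d" "\<And>n. (r n, r (Suc n)) \<in> next_arcs" by blast
  then have "r \<in> rays" by (simp add: rays_iff)
  then have "cofinal T arev `` {r} \<in> cyl (r 0)"
    using end_of_ray cyl_shift by blast
  with assms \<open>r 0 = d\<close> show False by simp
qed

text \<open>
  Restricting to nonempty cylinders makes the arcs of a level correspond to disjoint nonempty sets,
  so that the continuations of different arcs do not overlap.
\<close>

definition level_sum :: "('d \<Rightarrow> 'm::ab_group_add) \<Rightarrow> 'x \<Rightarrow> nat \<Rightarrow> (nat \<Rightarrow> 'd) set set \<Rightarrow> 'm" where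
  "level_sum f x n U = (\<Sum>d | d \<in> level x n \<and> cyl d \<noteq> {} \<and> cyl d \<subseteq> U. f d)"

text \<open>
  Kirchhoff's law at the head of each arc says exactly that refining the partition by one level
  does not change the sum.
\<close>

lemma level_sum_Suc:
  assumes f: "flow f" and U: "resolves x n U"
  shows "level_sum f x (Suc n) U = level_sum f x n U"
proof -
  let ?A = "{d. d \<in> level x n \<and> cyl d \<noteq> {} \<and> cyl d \<subseteq> U}"
  let ?B = "\<lambda>d. {e \<in> next_arcs `` {d}. cyl e \<noteq> {}}"
  have "{e. e \<in> level x (Suc n) \<and> cyl e \<noteq> {} \<and> cyl e \<subseteq> U} = (\<Union>d\<in>?A. ?B d)" (is "?L = ?R")
  proof
    show "?L \<subseteq> ?R"
    proof
      fix e assume e: "e \<in> ?L"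
      then obtain d where d: "d \<in> level x n" "(d, e) \<in> next_arcs" by (auto simp: level_Suc)
      then have "cyl e \<subseteq> cyl d" by (simp add: cyl_next_subset)
      with d e U have "d \<in> ?A" unfolding resolves_def by blast
      with d e show "e \<in> ?R" by auto
    qed
    show "?R \<subseteq> ?L"
      using cyl_next_subset by (fastforce simp: level_Suc)
  qed
  then have "level_sum f x (Suc n) U = (\<Sum>e\<in>(\<Union>d\<in>?A. ?B d). f e)"
    unfolding level_sum_def by simp
  also have "\<dots> = (\<Sum>d\<in>?A. \<Sum>e\<in>?B d. f e)"
  proof (rule sum.UNION_disjoint)
    show "finite ?A" using finite_level by simp
    show "\<forall>d\<in>?A. finite (?B d)"
      using finite_next level_arcs by (blast intro: finite_subset[of "?B _" "next_arcs `` {_}"])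
    show "\<forall>d\<in>?A. \<forall>d'\<in>?A. d \<noteq> d' \<longrightarrow> ?B d \<inter> ?B d' = {}"
    proof (intro ballI impI)
      fix d d' assume "d \<in> ?A" "d' \<in> ?A" "d \<noteq> d'"
      then have "cyl d \<inter> cyl d' = {}"
        using level_disjoint[of x n] by (auto simp: disjoint_family_on_def)
      then show "?B d \<inter> ?B d' = {}" using cyl_next_subset by blast
    qed
  qed
  also have "\<dots> = (\<Sum>d\<in>?A. f d)"
  proof (rule sum.cong)
    fix d assume "d \<in> ?A"
    then have d: "d \<in> arcs T" using level_arcs by auto
    have "(\<Sum>e\<in>?B d. f e) = (\<Sum>e\<in>next_arcs `` {d}. f e)"
      using finite_next[OF d] flow_dead[OF f]
      by (intro sum.mono_neutral_left) (auto simp: next_arcs_def)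
    with flow_next[OF f d] show "(\<Sum>e\<in>?B d. f e) = f d" by simp
  qed simp
  finally show ?thesis unfolding level_sum_def .
qed

lemma level_sum_eq:
  assumes "flow f" "resolves x m U" "m \<le> n"
  shows "level_sum f x n U = level_sum f x m U"
  using assms(3)
proof (induction n rule: dec_induct)
  case (step n)
  then show ?case
    using level_sum_Suc[OF assms(1) resolves_mono[OF step(1) assms(2)]] by simp
qed simp

definition flow_distribution ::
  "'x \<Rightarrow> ('d \<Rightarrow> 'm::ab_group_add) \<Rightarrow> (nat \<Rightarrow> 'd) set set \<Rightarrow> 'm" where
  "flow_distribution x f U =
     (if clopenin ends U then level_sum f x (LEAST n. resolves x n U) U else 0)"

lemma flow_distribution_level:
  assumes "flow f" "clopenin ends U" "resolves x n U"
  shows "flow_distribution x f U = level_sum f x n U"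
proof -
  have "level_sum f x n U = level_sum f x (LEAST n. resolves x n U) U"
    using assms(1,3) by (intro level_sum_eq) (auto intro: LeastI Least_le)
  with assms(2) show ?thesis by (simp add: flow_distribution_def)
qed

lemma distribution_flow_distribution:
  assumes f: "flow f"
  shows "distribution ends (flow_distribution x f)"
  unfolding distribution_def
proof (intro conjI allI impI)
  fix U W assume *: "clopenin ends U \<and> clopenin ends W \<and> U \<inter> W = {}"
  then obtain m n where "resolves x m U" "resolves x n W" using clopen_resolved by metis
  then have UW: "resolves x (m + n) U" "resolves x (m + n) W"
    using resolves_mono[OF le_add1] resolves_mono[OF le_add2] by blast+
  then have "resolves x (m + n) (U \<union> W)" unfolding resolves_def by blast
  moreover have "level_sum f x (m + n) (U \<union> W) = level_sum f x (m + n) U + level_sum f x (m + n) W"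
  proof -
    have "{d. d \<in> level x (m + n) \<and> cyl d \<noteq> {} \<and> cyl d \<subseteq> U \<union> W} =
        {d. d \<in> level x (m + n) \<and> cyl d \<noteq> {} \<and> cyl d \<subseteq> U} \<union>
        {d. d \<in> level x (m + n) \<and> cyl d \<noteq> {} \<and> cyl d \<subseteq> W}"
      using UW unfolding resolves_def by blast
    then show ?thesis
      unfolding level_sum_def using * finite_level by (subst sum.union_disjoint[symmetric]) auto
  qed
  ultimately show "flow_distribution x f (U \<union> W) = flow_distribution x f U + flow_distribution x f W"
    using * UW by (simp add: flow_distribution_level[OF f, of _ x "m + n"] clopenin_Un)
qed (simp add: flow_distribution_def)

lemma flow_distribution_total:
  assumes f: "flow f" and x: "x \<in> verts T"
  shows "flow_distribution x f (boundary T arev) = 0"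
proof -
  have "resolves x 0 (boundary T arev)"
    using cyl_subset_boundary by (auto simp: resolves_def)
  then have "flow_distribution x f (boundary T arev) = level_sum f x 0 (boundary T arev)"
    by (rule flow_distribution_level[OF f clopenin_boundary])
  also have "\<dots> = (\<Sum>d\<in>out_arcs T x. f d)"
    unfolding level_sum_def using finite_out_arcs cyl_subset_boundary flow_dead[OF f]
    by (intro sum.mono_neutral_left) auto
  also have "\<dots> = 0" using f x by (simp add: flow_def)
  finally show ?thesis .
qed

text \<open>
  For arcs pointing away from \<open>x\<close> this is the definition at their own level. The other arcs follow
  by reversal, since both sides are antisymmetric.
\<close>

lemma flow_distribution_cyl:
  assumes f: "flow f" and x: "x \<in> verts T" and d: "d \<in> arcs T"
  shows "flow_distribution x f (cyl d) = f d"
proof -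
  have level_case: "flow_distribution x f (cyl e) = f e" if e: "e \<in> level x n" for e n
  proof -
    have disj: "a = e \<or> cyl a \<inter> cyl e = {}" if "a \<in> level x n" for a
      using e that level_disjoint[of x n] by (auto simp: disjoint_family_on_def)
    then have "resolves x n (cyl e)" unfolding resolves_def by blast
    then have "flow_distribution x f (cyl e) = level_sum f x n (cyl e)"
      using flow_distribution_level[OF f] clopenin_cyl level_arcs e by blast
    also have "\<dots> = f e"
    proof (cases "cyl e = {}")
      case True
      then have "f e = 0" using flow_dead[OF f] level_arcs e by blast
      with True show ?thesis by (simp add: level_sum_def)
    next
      case False
      with disj e have "{a. a \<in> level x n \<and> cyl a \<noteq> {} \<and> cyl a \<subseteq> cyl e} = {e}" by blast
      then show ?thesis by (simp add: level_sum_def)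
    qed
    finally show ?thesis .
  qed
  from arc_or_reverse_in_level[OF x d] obtain n where "d \<in> level x n \<or> arev d \<in> level x n" ..
  then show ?thesis
  proof
    assume "arev d \<in> level x n"
    then have "flow_distribution x f (cyl (arev d)) = - f d"
      using level_case f d by (simp add: flow_def)
    moreover have "flow (\<lambda>d. flow_distribution x f (cyl d))"
      using distribution_imp_flow distribution_flow_distribution flow_distribution_total f x by blast
    ultimately show ?thesis using d by (simp add: flow_def)
  qed (rule level_case)
qed

end

section \<open>Lifting walks to the universal covering tree\<close>

lemma not_successivelyE:
  assumes "\<not> successively P w"
  obtains u a b v where "w = u @ [a, b] @ v" "\<not> P a b"
proof -
  from assms obtain i where i: "Suc i < length w" "\<not> P (w ! i) (w ! Suc i)"
    by (auto simp: successively_conv_nth)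
  then have "w = take i w @ [w ! i, w ! Suc i] @ drop (Suc (Suc i)) w"
    by (simp add: Cons_nth_drop_Suc)
  with i that show thesis by blast
qed

lemma (in wf_digraph) awalk_end_unique:
  "awalk u p v \<Longrightarrow> awalk u p v' \<Longrightarrow> v = v'"
  by (elim awalkE) simp

text \<open>
  The base graph \<open>G\<close> is finite, and the tree \<open>T\<close> inherits local finiteness from it because the
  projection is bijective on the arcs leaving a vertex.
\<close>

locale universal_cover = G: bidirected_digraph G arev + G: fin_digraph G + reversal_tree_digraph T arevT
  for G :: "('v, 'e) pre_digraph" and arev :: "'e \<Rightarrow> 'e"
    and T :: "('x, 'd) pre_digraph" and arevT :: "'d \<Rightarrow> 'd" +
  fixes pV :: "'x \<Rightarrow> 'v" and pE :: "'d \<Rightarrow> 'e"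
  assumes covering: "covering G arev T arevT pV pE"
begin

lemma pE_arc: "d \<in> arcs T \<Longrightarrow> pE d \<in> arcs G"
  and tail_pE: "d \<in> arcs T \<Longrightarrow> tail G (pE d) = pV (tail T d)"
  and head_pE: "d \<in> arcs T \<Longrightarrow> head G (pE d) = pV (head T d)"
  and pE_arev: "d \<in> arcs T \<Longrightarrow> pE (arevT d) = arev (pE d)"
  and pV_image: "pV ` verts T = verts G"
  and pE_bij: "x \<in> verts T \<Longrightarrow> bij_betw pE (out_arcs T x) (out_arcs G (pV x))"
  using covering unfolding covering_def by blast+

lemma pE_inj:
  assumes "d \<in> arcs T" "e \<in> arcs T" "tail T d = tail T e" "pE d = pE e"
  shows "d = e"
  using pE_bij[of "tail T e"] assms by (auto simp: bij_betw_def inj_on_def)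

lemma arc_lift:
  assumes "x \<in> verts T" "a \<in> arcs G" "tail G a = pV x"
  obtains d where "d \<in> arcs T" "tail T d = x" "pE d = a"
proof -
  have "a \<in> pE ` out_arcs T x"
    using pE_bij[OF assms(1)] assms by (auto simp: bij_betw_def)
  then show thesis using that by auto
qed

lemma arc_lift_exists:
  assumes "a \<in> arcs G"
  obtains d where "d \<in> arcs T" "pE d = a"
proof -
  have "tail G a \<in> pV ` verts T" using assms pV_image by simp
  then obtain x where "x \<in> verts T" "tail G a = pV x" by blast
  with assms show thesis using that arc_lift by metis
qed

sublocale locally_finite_reversal_tree T arevT
proof
  fix x
  show "finite (out_arcs T x)"
  proof (cases "x \<in> verts T")
    case True
    then show ?thesis using bij_betw_finite[OF pE_bij] finite_subset[of "out_arcs G (pV x)" "arcs G"] G.finite_arcs by auto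
  next
    case False
    then have "out_arcs T x = {}" by auto
    then show ?thesis by simp
  qed
qed

lemma walk_project:
  "awalk x w y \<Longrightarrow> G.awalk (pV x) (map pE w) (pV y)"
proof (induction w arbitrary: x)
  case Nil
  then show ?case using pV_image by (auto simp: awalk_simps G.awalk_simps)
next
  case (Cons d w)
  then show ?case by (auto simp: awalk_simps G.awalk_simps pE_arc tail_pE head_pE)
qed

lemma walk_lift:
  assumes "x \<in> verts T" "G.awalk (pV x) u v"
  shows "\<exists>w y. awalk x w y \<and> map pE w = u \<and> pV y = v"
  using assms
proof (induction u arbitrary: x)
  case Nil
  then have "awalk x [] x \<and> map pE [] = [] \<and> pV x = v"
    by (auto simp: awalk_simps G.awalk_simps)
  then show ?case by (intro exI)
next
  case (Cons a u)
  then have a: "a \<in> arcs G" "tail G a = pV x" "G.awalk (head G a) u v"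
    by (auto simp: G.awalk_simps)
  obtain d where d: "d \<in> arcs T" "tail T d = x" "pE d = a"
    using arc_lift Cons.prems(1) a(1,2) .
  with a(3) Cons.IH[of "head T d"] obtain w y
    where "awalk (head T d) w y" "map pE w = u" "pV y = v"
    by (auto simp flip: head_pE)
  with d have "awalk x (d # w) y \<and> map pE (d # w) = a # u \<and> pV y = v"
    by (auto simp: awalk_simps)
  then show ?case by (intro exI)
qed

lemma walk_lift_unique:
  assumes "awalk x w y" "awalk x w' y'" "map pE w = map pE w'"
  shows "y = y'"
proof -
  have "w = w'"
    using assms
  proof (induction w arbitrary: x w')
    case (Cons d w)
    then obtain d' v where w': "w' = d' # v" "pE d = pE d'" "map pE w = map pE v" by auto
    with Cons.prems have "d = d'"
      by (intro pE_inj) (auto simp: awalk_simps)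
    with Cons w' show ?case by (auto simp: awalk_simps)
  qed auto
  with assms show ?thesis using awalk_end_unique by blast
qed

lemma lifted_reversal:
  assumes "b \<in> arcs T" "c \<in> arcs T" "tail T c = head T b" "pE c = arev (pE b)"
  shows "c = arevT b"
  using assms by (intro pE_inj) (auto simp: pE_arev)

text \<open>
  A cancelling pair below can only come from a cancelling pair above, because lifts of an arc from
  a given vertex are unique.
\<close>

lemma awalk_cancel:
  assumes "awalk x (u @ [b, c] @ v) y" "pE c = arev (pE b)"
  shows "awalk x (u @ v) y"
proof -
  from assms(1) obtain p where "awalk x u p" "b \<in> arcs T" "tail T b = p"
    "c \<in> arcs T" "tail T c = head T b" "awalk (head T c) v y"
    by (auto simp: awalk_simps)
  moreover from this have "head T c = p"
    using lifted_reversal[of b c] assms(2) by simp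
  ultimately show ?thesis by auto
qed

text \<open>
  The tree is simply connected: a closed walk reduces to the empty walk by cancelling pairs
  \<open>a, arevT a\<close>, and each cancellation can be copied in any other lift of the same projection.
\<close>

lemma closed_walk_lifts_closed:
  assumes "awalk x w x" "awalk y w' z" "map pE w = map pE w'"
  shows "z = y"
  using assms
proof (induction "length w" arbitrary: w w' rule: less_induct)
  case less
  show ?case
  proof (cases "non_backtracking arevT w")
    case True
    with less.prems have "w = []" by (intro closed_reduced_walk_Nil)
    with less.prems show ?thesis by (auto simp: awalk_simps)
  next
    case False
    then obtain u a b v where "w = u @ [a, b] @ v" "\<not> b \<noteq> arevT a"
      unfolding non_backtracking_def by (rule not_successivelyE)
    then have w: "w = u @ [a, arevT a] @ v" by simp
    with less.prems(3) obtain u' b c v' where w': "w' = u' @ [b, c] @ v'"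
        "map pE u = map pE u'" "map pE v = map pE v'" "pE a = pE b" "pE (arevT a) = pE c"
      by (auto simp: append_eq_map_conv Cons_eq_map_conv)
    have "a \<in> arcs T" using less.prems(1) w by (auto simp: awalk_simps)
    then have inverse: "pE (arevT a) = arev (pE a)" by (rule pE_arev)
    have "awalk x (u @ v) x"
      using less.prems(1) inverse unfolding w by (rule awalk_cancel)
    moreover have "awalk y (u' @ v') z"
      using less.prems(2) unfolding w'(1)
      by (rule awalk_cancel) (use inverse w'(4,5) in simp)
    ultimately show ?thesis
      using less.hyps[of "u @ v" "u' @ v'"] w w' by simp
  qed
qed

section \<open>Deck transformations\<close>

text \<open>
  The graph of the deck transformation that takes \<open>x\<close> to \<open>y\<close>: follow from \<open>y\<close> the arcs with the
  same projections as those of a walk from \<open>x\<close> to \<open>z\<close>. Being symmetric in the two copies of the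
  tree, this relation gives the inverse transformation as well.
\<close>

definition companion :: "'x \<Rightarrow> 'x \<Rightarrow> 'x \<Rightarrow> 'x \<Rightarrow> bool" where
  "companion x y z z' \<longleftrightarrow> (\<exists>w w'. awalk x w z \<and> awalk y w' z' \<and> map pE w = map pE w')"

lemma companion_sym: "companion x y z z' \<Longrightarrow> companion y x z' z"
  unfolding companion_def by metis

lemma companion_base: "x \<in> verts T \<Longrightarrow> y \<in> verts T \<Longrightarrow> companion x y x y"
  unfolding companion_def by (intro exI[of _ "[]"]) (auto simp: awalk_simps)

lemma companion_verts: "companion x y z z' \<Longrightarrow> z \<in> verts T \<and> z' \<in> verts T"
  unfolding companion_def using awalk_last_in_verts by blast

lemma companion_exists:
  assumes "x \<in> verts T" "y \<in> verts T" "pV x = pV y" "z \<in> verts T"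
  shows "\<exists>z'. companion x y z z'"
proof -
  obtain w where w: "awalk x w z" using walk_exists assms by blast
  then obtain w' z' where "awalk y w' z'" "map pE w' = map pE w"
    using walk_lift[OF assms(2)] walk_project assms(3) by metis
  with w show ?thesis unfolding companion_def by metis
qed

lemma companion_pV:
  assumes "companion x y z z'" "pV x = pV y"
  shows "pV z = pV z'"
  using assms G.awalk_end_unique walk_project unfolding companion_def by metis

lemma map_pE_reverse:
  "set w \<subseteq> arcs T \<Longrightarrow> map pE (rev (map arevT w)) = rev (map arev (map pE w))"
  by (induction w) (auto simp: pE_arev)

text \<open>
  Two walks from \<open>x\<close> to \<open>z\<close> together form a closed walk, whose lift at \<open>y\<close> is closed again.
\<close>

lemma companion_unique:
  assumes "pV x = pV y" "companion x y z a" "companion x y z b"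
  shows "a = b"
proof -
  obtain v v' where v: "awalk x v z" "awalk y v' a" "map pE v = map pE v'"
    using assms(2) unfolding companion_def by blast
  obtain w w' where w: "awalk x w z" "awalk y w' b" "map pE w = map pE w'"
    using assms(3) unfolding companion_def by blast
  let ?r = "rev (map arevT w)"
  have r: "awalk z ?r x" using w(1) by (rule awalk_reverse)
  have "a \<in> verts T" "pV z = pV a"
    using companion_verts companion_pV assms by blast+
  then obtain s c where s: "awalk a s c" "map pE s = map pE ?r"
    using walk_lift[of a "map pE ?r" "pV x"] walk_project[OF r] by metis
  have "c = y"
    using closed_walk_lifts_closed[of x "v @ ?r" y "v' @ s" c] v s r by auto
  with s have a_walk: "awalk y (rev (map arevT s)) a" using awalk_reverse by blast
  have arcs: "set w \<subseteq> arcs T" "set s \<subseteq> arcs T" using w s by auto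
  then have "map pE (rev (map arevT s)) = rev (map arev (map pE ?r))"
    using map_pE_reverse s(2) by metis
  also have "\<dots> = map pE w"
    using map_pE_reverse[OF arcs(1)] by (simp add: rev_map comp_def)
  finally show "a = b"
    using walk_lift_unique[OF a_walk w(2)] w(3) by simp
qed

lemma companion_step:
  assumes "companion x y z z'" "d \<in> arcs T" "tail T d = z" "d' \<in> arcs T" "tail T d' = z'" "pE d = pE d'"
  shows "companion x y (head T d) (head T d')"
proof -
  obtain w w' where "awalk x w z" "awalk y w' z'" "map pE w = map pE w'"
    using assms(1) unfolding companion_def by blast
  with assms have "awalk x (w @ [d]) (head T d)" "awalk y (w' @ [d']) (head T d')"
    "map pE (w @ [d]) = map pE (w' @ [d'])"
    by (auto simp: awalk_simps)
  then show ?thesis unfolding companion_def by blast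
qed

abbreviation deck :: "(('x \<Rightarrow> 'x) \<times> ('d \<Rightarrow> 'd)) set" where
  "deck \<equiv> deck_transformations T arevT pV pE"

lemma deckD:
  assumes "(gV, gE) \<in> deck"
  shows "gV permutes verts T" "gE permutes arcs T"
    and "d \<in> arcs T \<Longrightarrow> tail T (gE d) = gV (tail T d)"
    and "d \<in> arcs T \<Longrightarrow> head T (gE d) = gV (head T d)"
    and "d \<in> arcs T \<Longrightarrow> gE (arevT d) = arevT (gE d)"
    and "d \<in> arcs T \<Longrightarrow> pE (gE d) = pE d"
    and "x \<in> verts T \<Longrightarrow> pV (gV x) = pV x"
    and "d \<in> arcs T \<longleftrightarrow> gE d \<in> arcs T"
    and "x \<in> verts T \<longleftrightarrow> gV x \<in> verts T"
  using assms unfolding deck_transformations_def by (auto simp: permutes_in_image)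

text \<open>
  The covering is regular: deck transformations act transitively on each fibre.
\<close>

lemma deck_exists:
  assumes x: "x \<in> verts T" and y: "y \<in> verts T" and xy: "pV x = pV y"
  obtains gV gE where "(gV, gE) \<in> deck" "gV x = y"
proof -
  have "\<forall>z. \<exists>z'. if z \<in> verts T then companion x y z z' else z' = z"
    using companion_exists[OF x y xy] by auto
  then obtain gV where gV: "\<And>z. if z \<in> verts T then companion x y z (gV z) else gV z = z"
    by metis
  then have comp: "companion x y z (gV z)" if "z \<in> verts T" for z
    using that by metis
  have gV_unique: "gV z = z'" if "companion x y z z'" for z z'
    using companion_unique[OF xy] comp that companion_verts by blast
  have gV_verts: "gV z \<in> verts T" and gV_pV: "pV (gV z) = pV z" if "z \<in> verts T" for z
    using comp[OF that] companion_verts companion_pV xy by metis+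
  have "\<forall>d. \<exists>d'. if d \<in> arcs T then d' \<in> arcs T \<and> tail T d' = gV (tail T d) \<and> pE d' = pE d else d' = d"
    using arc_lift gV_verts gV_pV pE_arc tail_pE by (metis tail_in_verts)
  then obtain gE where gE:
    "\<And>d. if d \<in> arcs T then gE d \<in> arcs T \<and> tail T (gE d) = gV (tail T d) \<and> pE (gE d) = pE d
        else gE d = d"
    by metis
  then have gE_arc: "gE d \<in> arcs T" and gE_tail: "tail T (gE d) = gV (tail T d)"
    and gE_pE: "pE (gE d) = pE d" if "d \<in> arcs T" for d
    using that by metis+
  have gE_head: "head T (gE d) = gV (head T d)" if d: "d \<in> arcs T" for d
    using companion_step[of x y "tail T d" "gV (tail T d)" d "gE d"] comp d gE_arc gE_tail gE_pE
      gV_unique by simp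
  have gE_arev: "gE (arevT d) = arevT (gE d)" if "d \<in> arcs T" for d
    using that gE_arc gE_tail gE_head gE_pE
    by (intro pE_inj) (auto simp: pE_arev)
  have "gV permutes verts T"
  proof (rule bij_imp_permutes)
    have "inj_on gV (verts T)"
    proof (rule inj_onI)
      fix z z' assume "z \<in> verts T" "z' \<in> verts T" "gV z = gV z'"
      then have "companion y x (gV z) z" "companion y x (gV z) z'"
        using comp companion_sym by metis+
      then show "z = z'" using companion_unique xy by metis
    qed
    moreover have "z' \<in> gV ` verts T" if "z' \<in> verts T" for z'
    proof -
      obtain z where "companion y x z' z"
        using companion_exists[OF y x xy[symmetric] \<open>z' \<in> verts T\<close>] by blast
      then have "companion x y z z'" by (rule companion_sym)
      then show ?thesis using gV_unique companion_verts by blast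
    qed
    ultimately show "bij_betw gV (verts T) (verts T)"
      using gV_verts by (auto simp: bij_betw_def)
  qed (use gV in metis)
  moreover from this have gV_inj: "gV z = gV z' \<Longrightarrow> z = z'" for z z'
    by (metis permutes_inj injD)
  have "gE permutes arcs T"
  proof (rule bij_imp_permutes)
    have "inj_on gE (arcs T)"
    proof (rule inj_onI)
      fix d d' assume d: "d \<in> arcs T" "d' \<in> arcs T" "gE d = gE d'"
      then have "tail T d = tail T d'" "pE d = pE d'" using gE_tail gE_pE gV_inj by metis+
      with d show "d = d'" by (intro pE_inj)
    qed
    moreover have "d' \<in> gE ` arcs T" if d': "d' \<in> arcs T" for d'
    proof -
      have "tail T d' \<in> gV ` verts T"
        using \<open>gV permutes verts T\<close> d' by (simp add: permutes_image)
      then obtain z where z: "z \<in> verts T" "gV z = tail T d'" by auto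
      then have "tail G (pE d') = pV z" using gV_pV tail_pE[OF d'] by metis
      then obtain d where d: "d \<in> arcs T" "tail T d = z" "pE d = pE d'"
        using arc_lift[OF z(1) pE_arc[OF d']] by metis
      then have "gE d = d'"
        using gE_arc gE_tail gE_pE z d' by (intro pE_inj) auto
      with d show ?thesis by blast
    qed
    ultimately show "bij_betw gE (arcs T) (arcs T)"
      using gE_arc by (auto simp: bij_betw_def)
  qed (use gE in metis)
  ultimately have "(gV, gE) \<in> deck"
    unfolding deck_transformations_def
    using gE_tail gE_head gE_arev gE_pE gV_pV by simp
  moreover have "gV x = y" using gV_unique companion_base x y by blast
  ultimately show thesis by (rule that)
qed

text \<open>
  Inverses are written \<open>inv_into UNIV\<close> because \<open>inv\<close> alone is also the notation for inverses in
  groups.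
\<close>

lemma deck_inverse:
  assumes g: "(gV, gE) \<in> deck"
  shows "(inv_into UNIV gV, inv_into UNIV gE) \<in> deck"
proof -
  note perm = deckD(1,2)[OF g] and inverse = permutes_inverses[OF deckD(1)[OF g]] permutes_inverses[OF deckD(2)[OF g]]
  have arc: "inv_into UNIV gE d \<in> arcs T" if "d \<in> arcs T" for d
    using deckD(8)[OF g, of "inv_into UNIV gE d"] inverse that by simp
  have vert: "inv_into UNIV gV z \<in> verts T" if "z \<in> verts T" for z
    using deckD(9)[OF g, of "inv_into UNIV gV z"] inverse that by simp
  have "tail T (inv_into UNIV gE d) = inv_into UNIV gV (tail T d)" "head T (inv_into UNIV gE d) = inv_into UNIV gV (head T d)"
    "inv_into UNIV gE (arevT d) = arevT (inv_into UNIV gE d)" "pE (inv_into UNIV gE d) = pE d" if "d \<in> arcs T" for d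
    using deckD(3,4,6)[OF g, of "inv_into UNIV gE d"] deckD(5)[OF g, of "inv_into UNIV gE d", symmetric]
      arc[OF that] inverse by simp_all
  moreover have "pV (inv_into UNIV gV z) = pV z" if "z \<in> verts T" for z
    using deckD(7)[OF g, of "inv_into UNIV gV z"] vert[OF that] inverse by simp
  ultimately show ?thesis
    using perm[THEN permutes_inv] unfolding deck_transformations_def by auto
qed

lemma deck_walk:
  assumes g: "(gV, gE) \<in> deck" and "awalk x w y"
  shows "awalk (gV x) (map gE w) (gV y)" "map pE (map gE w) = map pE w"
  using assms(2)
  by (induction w arbitrary: x)
    (use deckD[OF g] in \<open>auto simp: awalk_simps\<close>)

text \<open>
  Deck transformations respect projections of walks, so they are determined by one value through
  the uniqueness of lifts.
\<close>

lemma deck_unique: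
  assumes g: "(gV, gE) \<in> deck" and h: "(hV, hE) \<in> deck"
    and x: "x \<in> verts T" "gV x = hV x"
  shows "(gV, gE) = (hV, hE)"
proof -
  have V: "gV z = hV z" for z
  proof (cases "z \<in> verts T")
    case True
    then obtain w where w: "awalk x w z" using walk_exists x by blast
    show ?thesis
      using deck_walk[OF g w] deck_walk[OF h w] x(2)
        walk_lift_unique[of "gV x" "map gE w" "gV z" "map hE w" "hV z"] by simp
  next
    case False
    then show ?thesis using deckD(1)[OF g] deckD(1)[OF h] by (simp add: permutes_not_in)
  qed
  moreover have "gE d = hE d" for d
  proof (cases "d \<in> arcs T")
    case True
    then show ?thesis using deckD(3,6,8)[OF g] deckD(3,6,8)[OF h] V by (intro pE_inj) auto
  next
    case False
    then show ?thesis using deckD(2)[OF g] deckD(2)[OF h] by (simp add: permutes_not_in)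
  qed
  ultimately show ?thesis by (simp add: fun_eq_iff)
qed

section \<open>The action of the fundamental group\<close>

definition lifts_to :: "'x \<Rightarrow> 'e list \<Rightarrow> 'x \<Rightarrow> bool" where
  "lifts_to x u y \<longleftrightarrow> (\<exists>w. awalk x w y \<and> map pE w = u)"

lemma lifts_to_elementary_reduction:
  assumes x: "x \<in> verts T" and uv: "(u, v) \<in> elementary_reductions G arev (pV x)"
  shows "lifts_to x u y \<longleftrightarrow> lifts_to x v y"
proof -
  from uv obtain u1 a u2 where u: "u = u1 @ [a, arev a] @ u2" "v = u1 @ u2"
    and closed: "G.awalk (pV x) u (pV x)"
    unfolding elementary_reductions_def closed_walks_def by blast
  show ?thesis
  proof
    assume "lifts_to x u y"
    then obtain w where "awalk x w y" "map pE w = u" unfolding lifts_to_def by blast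
    moreover from this u obtain w1 b c w2 where "w = w1 @ [b, c] @ w2"
        "map pE w1 = u1" "map pE w2 = u2" "pE b = a" "pE c = arev a"
      by (auto simp: map_eq_append_conv map_eq_Cons_conv)
    ultimately have "awalk x (w1 @ w2) y" "map pE (w1 @ w2) = v"
      using awalk_cancel u by auto
    then show "lifts_to x v y" unfolding lifts_to_def by blast
  next
    assume "lifts_to x v y"
    then obtain w1 w2 p where w: "awalk x w1 p" "awalk p w2 y" "map pE w1 = u1" "map pE w2 = u2"
      unfolding lifts_to_def u by (auto simp: map_eq_append_conv)
    have "G.awalk (pV x) u1 (tail G a)" "a \<in> arcs G"
      using closed u by (auto simp: G.awalk_simps)
    moreover from this have "tail G a = pV p"
      using G.awalk_end_unique walk_project[OF w(1)] w(3) by blast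
    moreover have "p \<in> verts T" using w(1) awalk_last_in_verts by blast
    ultimately obtain b where b: "b \<in> arcs T" "tail T b = p" "pE b = a"
      using arc_lift by metis
    then have "awalk x (w1 @ [b, arevT b] @ w2) y" "map pE (w1 @ [b, arevT b] @ w2) = u"
      using w u by (auto simp: awalk_simps pE_arev)
    then show "lifts_to x u y" unfolding lifts_to_def by blast
  qed
qed

text \<open>
  Homotopic loops have lifts with the same end point. This makes the deck transformation attached
  to a homotopy class independent of the loop that represents it.
\<close>

lemma lifts_to_homotopy:
  assumes x: "x \<in> verts T" and uv: "(u, v) \<in> homotopy G arev (pV x)"
  shows "lifts_to x u y \<longleftrightarrow> lifts_to x v y"
proof -
  from uv have "(u, v) \<in> (elementary_reductions G arev (pV x) \<union> (elementary_reductions G arev (pV x))\<inverse>)\<^sup>*"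
    unfolding homotopy_def by blast
  then show ?thesis
    by (induction rule: rtrancl_induct) (use lifts_to_elementary_reduction[OF x] in auto)
qed

lemma deck_action_eq:
  assumes x: "x \<in> verts T" and \<gamma>: "\<gamma> \<in> carrier (fundamental_group G arev (pV x))"
    and u: "u \<in> \<gamma>" "lifts_to x u (gV x)" and g: "(gV, gE) \<in> deck"
  shows "deck_action T arevT pV pE x \<gamma> = (gV, gE)"
  unfolding deck_action_def
proof (rule the_equality)
  show "(gV, gE) \<in> deck \<and> (\<exists>w. map pE w \<in> \<gamma> \<and> awalk x w (fst (gV, gE) x))"
    using u g unfolding lifts_to_def by auto
next
  fix h assume h: "h \<in> deck \<and> (\<exists>w. map pE w \<in> \<gamma> \<and> awalk x w (fst h x))"
  obtain hV hE where hh: "h = (hV, hE)" by (cases h)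
  with h obtain w where w: "map pE w \<in> \<gamma>" "awalk x w (hV x)" by auto
  from \<gamma> obtain u0 where u0: "\<gamma> = homotopy G arev (pV x) `` {u0}"
    by (auto simp: fundamental_group_def elim: quotientE)
  have "lifts_to x (map pE w) (hV x)" using w unfolding lifts_to_def by blast
  then have "lifts_to x u (hV x)"
    using lifts_to_homotopy[OF x] u0 u(1) w(1) by blast
  with u(2) have "gV x = hV x"
    using walk_lift_unique unfolding lifts_to_def by metis
  with h hh show "h = (gV, gE)" using deck_unique[OF _ g x] by auto
qed

lemma homotopy_refl: "u \<in> closed_walks G v \<Longrightarrow> (u, u) \<in> homotopy G arev v"
  by (simp add: homotopy_def)

lemma deck_action_in_deck:
  assumes x: "x \<in> verts T" and \<gamma>: "\<gamma> \<in> carrier (fundamental_group G arev (pV x))"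
  shows "deck_action T arevT pV pE x \<gamma> \<in> deck"
proof -
  from \<gamma> obtain u where "u \<in> closed_walks G (pV x)" "\<gamma> = homotopy G arev (pV x) `` {u}"
    by (auto simp: fundamental_group_def elim: quotientE)
  then have u: "u \<in> \<gamma>" "G.awalk (pV x) u (pV x)"
    by (auto simp: closed_walks_def intro: homotopy_refl)
  then obtain w y where w: "awalk x w y" "map pE w = u" "pV y = pV x"
    using walk_lift x by blast
  then have "lifts_to x u y" "y \<in> verts T" unfolding lifts_to_def by auto
  then obtain gV gE where g: "(gV, gE) \<in> deck" "gV x = y"
    using deck_exists[of x y] x w(3) by metis
  then have "deck_action T arevT pV pE x \<gamma> = (gV, gE)"
    using \<open>lifts_to x u y\<close> by (intro deck_action_eq[OF x \<gamma> u(1)]) auto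
  with g show ?thesis by simp
qed

text \<open>
  The deck transformation taking \<open>d\<close> to \<open>e\<close> moves \<open>x\<close> to some vertex of the same fibre; the class
  \<open>\<gamma>\<close> is that of the projection of a walk from \<open>x\<close> to this vertex.
\<close>

lemma deck_action_transitive:
  assumes x: "x \<in> verts T" and d: "d \<in> arcs T" "e \<in> arcs T" "pE d = pE e"
  obtains \<gamma> where "\<gamma> \<in> carrier (fundamental_group G arev (pV x))"
    "snd (deck_action T arevT pV pE x \<gamma>) d = e"
proof -
  obtain gV gE where g: "(gV, gE) \<in> deck" "gV (tail T d) = tail T e"
    using deck_exists[of "tail T d" "tail T e"] d tail_pE by (metis tail_in_verts)
  have "gE d = e" using deckD(3,6,8)[OF g(1)] g(2) d by (intro pE_inj) auto
  obtain w where w: "awalk x w (gV x)" using walk_exists x deckD(9)[OF g(1)] by blast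
  let ?\<gamma> = "homotopy G arev (pV x) `` {map pE w}"
  have "map pE w \<in> closed_walks G (pV x)"
    using walk_project[OF w] deckD(7)[OF g(1) x] by (simp add: closed_walks_def)
  then have \<gamma>: "?\<gamma> \<in> carrier (fundamental_group G arev (pV x))" "map pE w \<in> ?\<gamma>"
    by (auto simp: fundamental_group_def quotientI homotopy_refl)
  have "deck_action T arevT pV pE x ?\<gamma> = (gV, gE)"
    using w by (intro deck_action_eq[OF x \<gamma> _ g(1)]) (auto simp: lifts_to_def)
  with \<gamma>(1) \<open>gE d = e\<close> show thesis using that by force
qed

abbreviation push :: "('d \<Rightarrow> 'd) \<Rightarrow> (nat \<Rightarrow> 'd) set \<Rightarrow> (nat \<Rightarrow> 'd) set" where
  "push gE \<equiv> image (comp gE)"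

lemma deck_ray:
  assumes g: "(gV, gE) \<in> deck" and "r \<in> rays"
  shows "gE \<circ> r \<in> rays"
proof -
  have "gE (r (Suc i)) \<noteq> arevT (gE (r i))" for i
    using assms(2) deckD(2,5)[OF g] unfolding semi_geodesics_def
    by (metis (mono_tags, lifting) mem_Collect_eq permutes_inj injD)
  with assms(2) deckD(3,4,8)[OF g] show ?thesis
    by (auto simp: semi_geodesics_def)
qed

lemma deck_cofinal:
  assumes g: "(gV, gE) \<in> deck" and "(r, s) \<in> cofinal T arevT"
  shows "(gE \<circ> r, gE \<circ> s) \<in> cofinal T arevT"
proof -
  obtain m n where "r \<in> rays" "s \<in> rays" "\<And>k. r (m + k) = s (n + k)"
    using assms(2) by (auto simp: cofinal_def)
  then show ?thesis
    by (intro cofinalI[of _ _ m n] deck_ray[OF g]) auto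
qed

lemma push_inverse:
  assumes g: "(gV, gE) \<in> deck"
  shows "push gE (push (inv_into UNIV gE) \<xi>) = \<xi>" "push (inv_into UNIV gE) (push gE \<xi>) = \<xi>"
  using permutes_inv_o[OF deckD(2)[OF g]] by (simp_all add: image_image flip: comp_assoc)

lemma push_boundary:
  assumes g: "(gV, gE) \<in> deck" and \<xi>: "\<xi> \<in> boundary T arevT"
  shows "push gE \<xi> \<in> boundary T arevT"
proof -
  obtain r where r: "r \<in> rays" "\<xi> = cofinal T arevT `` {r}" using \<xi> by (rule boundaryE)
  have "push gE \<xi> = cofinal T arevT `` {gE \<circ> r}"
  proof
    show "push gE \<xi> \<subseteq> cofinal T arevT `` {gE \<circ> r}" using deck_cofinal[OF g] r by auto
    show "cofinal T arevT `` {gE \<circ> r} \<subseteq> push gE \<xi>"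
    proof
      fix s assume "s \<in> cofinal T arevT `` {gE \<circ> r}"
      then have "(inv_into UNIV gE \<circ> (gE \<circ> r), inv_into UNIV gE \<circ> s) \<in> cofinal T arevT"
        using deck_cofinal[OF deck_inverse[OF g]] by blast
      then have "inv_into UNIV gE \<circ> s \<in> \<xi>"
        using permutes_inv_o(2)[OF deckD(2)[OF g]] r by (simp flip: comp_assoc)
      moreover have "s = gE \<circ> (inv_into UNIV gE \<circ> s)"
        using permutes_inv_o(1)[OF deckD(2)[OF g]] by (simp flip: comp_assoc)
      ultimately show "s \<in> push gE \<xi>" by blast
    qed
  qed
  then show ?thesis using end_of_ray(1)[OF deck_ray[OF g r(1)]] by simp
qed

lemma push_cyl_subset:
  assumes g: "(gV, gE) \<in> deck"
  shows "push gE ` cyl d \<subseteq> cyl (gE d)"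
  using push_boundary[OF g] by (force simp: boundary_cylinder_def)

lemma push_cyl:
  assumes g: "(gV, gE) \<in> deck"
  shows "push gE ` cyl d = cyl (gE d)"
proof
  have "push (inv_into UNIV gE) ` cyl (gE d) \<subseteq> cyl d"
    using push_cyl_subset[OF deck_inverse[OF g], of "gE d"] permutes_inverses(2)[OF deckD(2)[OF g]]
    by simp
  then have "push gE ` push (inv_into UNIV gE) ` cyl (gE d) \<subseteq> push gE ` cyl d" by blast
  then show "cyl (gE d) \<subseteq> push gE ` cyl d"
    using push_inverse(1)[OF g] by (simp add: image_image)
qed (rule push_cyl_subset[OF g])

text \<open>
  It suffices to compare on cylinders, since a clopen set and its translate are partitioned by
  corresponding cylinders.
\<close>

lemma deck_invariance:
  assumes g: "(gV, gE) \<in> deck" and \<nu>: "distribution ends \<nu>"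
    and cyl_inv: "\<And>d. d \<in> arcs T \<Longrightarrow> \<nu> (cyl (gE d)) = \<nu> (cyl d)"
    and U: "clopenin ends U"
  shows "\<nu> (push gE ` U) = \<nu> U"
proof -
  obtain D where D: "finite D" "D \<subseteq> arcs T" "disjoint_family_on cyl D" "U = (\<Union>d\<in>D. cyl d)"
    using U by (rule clopen_cylinder_partition)
  have "inj (push gE)" using push_inverse(2)[OF g] by (rule inj_on_inverseI)
  then have "disjoint_family_on (\<lambda>d. cyl (gE d)) D"
    using D(3) unfolding disjoint_family_on_def by (simp flip: push_cyl[OF g] image_Int)
  moreover have "clopenin ends (cyl (gE d))" if "d \<in> D" for d
    using that D deckD(8)[OF g] clopenin_cyl by blast
  ultimately have "\<nu> (\<Union>d\<in>D. cyl (gE d)) = (\<Sum>d\<in>D. \<nu> (cyl (gE d)))"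
    using distribution_Union[OF \<nu> D(1), of "\<lambda>d. cyl (gE d)"] by blast
  also have "\<dots> = (\<Sum>d\<in>D. \<nu> (cyl d))"
    using D(2) cyl_inv by (intro sum.cong) auto
  also have "\<dots> = \<nu> U"
    using distribution_Union[OF \<nu> D(1) clopenin_cyl D(3)] D(2) unfolding D(4) by (metis subsetD)
  finally show ?thesis
    using D(4) by (simp add: image_UN push_cyl[OF g])
qed

abbreviation group_action :: "'x \<Rightarrow> 'e list set \<Rightarrow> (nat \<Rightarrow> 'd) set \<Rightarrow> (nat \<Rightarrow> 'd) set" where
  "group_action \<equiv> boundary_action T arevT pV pE"

lemma group_action_eq_push: "group_action x \<gamma> = push (snd (deck_action T arevT pV pE x \<gamma>))"
  by (simp add: boundary_action_def fun_eq_iff comp_def)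

text \<open>
  Invariance under the fundamental group is constancy on the fibres of the projection of arcs, as
  the group permutes the arcs of each fibre transitively.
\<close>

lemma invariant_iff:
  assumes x: "x \<in> verts T" and \<nu>: "distribution ends \<nu>"
  shows "(\<forall>\<gamma>\<in>carrier (fundamental_group G arev (pV x)). \<forall>U. clopenin ends U \<longrightarrow>
        \<nu> (group_action x \<gamma> ` U) = \<nu> U) \<longleftrightarrow>
    (\<forall>d\<in>arcs T. \<forall>e\<in>arcs T. pE d = pE e \<longrightarrow> \<nu> (cyl d) = \<nu> (cyl e))" (is "?L \<longleftrightarrow> ?R")
proof
  assume L: ?L
  show ?R
  proof (intro ballI impI)
    fix d e assume d: "d \<in> arcs T" "e \<in> arcs T" "pE d = pE e"
    then obtain \<gamma> where \<gamma>: "\<gamma> \<in> carrier (fundamental_group G arev (pV x))"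
        "snd (deck_action T arevT pV pE x \<gamma>) d = e"
      using deck_action_transitive[OF x] by blast
    obtain gV gE where g: "deck_action T arevT pV pE x \<gamma> = (gV, gE)" by fastforce
    then have "(gV, gE) \<in> deck" using deck_action_in_deck[OF x \<gamma>(1)] by simp
    then have "group_action x \<gamma> ` cyl d = cyl e"
      using push_cyl \<gamma>(2) g unfolding group_action_eq_push by simp
    then show "\<nu> (cyl d) = \<nu> (cyl e)" using L \<gamma>(1) clopenin_cyl[OF d(1)] by metis
  qed
next
  assume R: ?R
  show ?L
  proof (intro ballI allI impI)
    fix \<gamma> U assume \<gamma>: "\<gamma> \<in> carrier (fundamental_group G arev (pV x))" and U: "clopenin ends U"
    obtain gV gE where g: "deck_action T arevT pV pE x \<gamma> = (gV, gE)" by fastforce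
    then have d: "(gV, gE) \<in> deck" using deck_action_in_deck[OF x \<gamma>] by simp
    have "\<nu> (push gE ` U) = \<nu> U"
    proof (rule deck_invariance[OF d \<nu> _ U])
      fix a assume "a \<in> arcs T"
      with R deckD(6,8)[OF d, of a] show "\<nu> (cyl (gE a)) = \<nu> (cyl a)" by blast
    qed
    then show "\<nu> (group_action x \<gamma> ` U) = \<nu> U"
      by (simp add: group_action_eq_push g)
  qed
qed

end

section \<open>Cycles of the base graph as flows\<close>

text \<open>
  The antisymmetric extension to all arcs of a chain given on the positively oriented ones.
\<close>

definition flow_of :: "('e \<Rightarrow> 'e) \<Rightarrow> 'e set \<Rightarrow> ('e \<Rightarrow>\<^sub>0 'm::ab_group_add) \<Rightarrow> 'e \<Rightarrow> 'm" where
  "flow_of arev Ep c a =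
     (if a \<in> Ep then Poly_Mapping.lookup c a else - Poly_Mapping.lookup c (arev a))"

lemma flow_of_add: "flow_of arev Ep (c + c') a = flow_of arev Ep c a + flow_of arev Ep c' a"
  by (simp add: flow_of_def lookup_add)

lemma (in bidirected_digraph) flow_of_arev:
  assumes "orientation G arev Ep" "a \<in> arcs G"
  shows "flow_of arev Ep c (arev a) = - flow_of arev Ep c a"
proof (cases "a \<in> Ep")
  case True
  then have "arev a \<notin> Ep" using assms(1) unfolding orientation_def by blast
  with True show ?thesis by (simp add: flow_of_def)
next
  case False
  then have "arev a \<in> Ep" using assms unfolding orientation_def by (metis UnE arev_arev imageE)
  with False show ?thesis by (simp add: flow_of_def)
qed

text \<open>
  The arcs leaving \<open>v\<close> are the positive arcs out of \<open>v\<close> and the reverses of the positive arcs into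
  \<open>v\<close>; a positive loop occurs in both ways, and its two contributions cancel on either side.
\<close>

lemma (in bidirected_digraph) lookup_boundary_hom:
  assumes fin: "fin_digraph G" and ori: "orientation G arev Ep"
    and c: "Poly_Mapping.keys c \<subseteq> Ep"
  shows "Poly_Mapping.lookup (boundary_hom G c) v = - (\<Sum>a\<in>out_arcs G v. flow_of arev Ep c a)"
proof -
  interpret fin_digraph G by fact
  have Ep: "Ep \<subseteq> arcs G" "finite Ep"
    using ori finite_subset[of Ep "arcs G"] finite_arcs unfolding orientation_def by auto
  let ?c = "Poly_Mapping.lookup c"
  let ?O = "{a \<in> Ep. tail G a = v}" and ?I = "{a \<in> Ep. head G a = v}"
  have "Poly_Mapping.lookup (boundary_hom G c) v =
      (\<Sum>a\<in>Poly_Mapping.keys c. (if head G a = v then ?c a else 0) - (if tail G a = v then ?c a else 0))"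
    by (simp add: boundary_hom_def lookup_sum lookup_minus lookup_single when_def)
  also have "\<dots> = (\<Sum>a\<in>Ep. (if head G a = v then ?c a else 0) - (if tail G a = v then ?c a else 0))"
    using c Ep(2) by (intro sum.mono_neutral_left) (auto simp: in_keys_iff)
  also have "\<dots> = (\<Sum>a\<in>?I. ?c a) - (\<Sum>a\<in>?O. ?c a)"
    using Ep(2) by (simp add: sum_subtractf sum.inter_filter)
  also have "\<dots> = - ((\<Sum>a\<in>?O. flow_of arev Ep c a) + (\<Sum>a\<in>arev ` ?I. flow_of arev Ep c a))"
  proof -
    have "(\<Sum>a\<in>arev ` ?I. flow_of arev Ep c a) = (\<Sum>a\<in>?I. - ?c a)"
    proof (subst sum.reindex, blast, rule sum.cong)
      fix a assume "a \<in> ?I"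
      then have "a \<in> Ep" "a \<in> arcs G" using Ep by auto
      then show "(flow_of arev Ep c \<circ> arev) a = - ?c a"
        using flow_of_arev[OF ori, of a c] by (simp add: flow_of_def[of _ _ _ a])
    qed simp
    moreover have "(\<Sum>a\<in>?O. flow_of arev Ep c a) = (\<Sum>a\<in>?O. ?c a)"
      by (auto intro!: sum.cong simp: flow_of_def)
    ultimately show ?thesis by (simp add: sum_negf)
  qed
  also have "(\<Sum>a\<in>?O. flow_of arev Ep c a) + (\<Sum>a\<in>arev ` ?I. flow_of arev Ep c a) =
      (\<Sum>a\<in>?O \<union> arev ` ?I. flow_of arev Ep c a)"
    using Ep(2) ori unfolding orientation_def by (intro sum.union_disjoint[symmetric]) auto
  also have "?O \<union> arev ` ?I = out_arcs G v"
    using ori Ep unfolding orientation_def by auto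
  finally show ?thesis .
qed

lemma (in bidirected_digraph) in_H1_iff:
  assumes "fin_digraph G" "orientation G arev Ep"
  shows "c \<in> carrier (H1 G Ep) \<longleftrightarrow>
    Poly_Mapping.keys c \<subseteq> Ep \<and> (\<forall>v\<in>verts G. (\<Sum>a\<in>out_arcs G v. flow_of arev Ep c a) = 0)"
proof -
  have "boundary_hom G c = 0 \<longleftrightarrow> (\<forall>v\<in>verts G. (\<Sum>a\<in>out_arcs G v. flow_of arev Ep c a) = 0)"
    if "Poly_Mapping.keys c \<subseteq> Ep"
  proof -
    have "(\<Sum>a\<in>out_arcs G v. flow_of arev Ep c a) = 0" if "v \<notin> verts G" for v
    proof -
      have "out_arcs G v = {}" using that by auto
      then show ?thesis by simp
    qed
    then show ?thesis
      unfolding poly_mapping_eq_iff fun_eq_iff lookup_boundary_hom[OF assms that] by auto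
  qed
  then show ?thesis
    by (auto simp: H1_def kernel_def formal_sums_def)
qed

section \<open>The isomorphism\<close>

context universal_cover
begin

text \<open>
  The projection is bijective on the arcs leaving a vertex, so Kirchhoff's law lifts to the tree.
\<close>

lemma flow_pullback:
  assumes "orientation G arev Ep" "c \<in> carrier (H1 G Ep)"
  shows "flow (\<lambda>d. flow_of arev Ep c (pE d))"
  unfolding flow_def
proof (intro conjI ballI)
  fix x assume x: "x \<in> verts T"
  have "(\<Sum>d\<in>out_arcs T x. flow_of arev Ep c (pE d)) = (\<Sum>a\<in>out_arcs G (pV x). flow_of arev Ep c a)"
    using pE_bij[OF x] by (rule sum.reindex_bij_betw)
  also have "\<dots> = 0"
    using assms x pV_image G.in_H1_iff[OF G.fin_digraph assms(1)] by auto
  finally show "(\<Sum>d\<in>out_arcs T x. flow_of arev Ep c (pE d)) = 0" .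
qed (simp add: pE_arev pE_arc G.flow_of_arev[OF assms(1)])

text \<open>
  The coefficient of a positive arc is the mass of the cylinder of any of its lifts; being a cycle
  is Kirchhoff's law for cylinder masses, read at one vertex over each vertex of \<open>G\<close>.
\<close>

lemma cycle_of_distribution:
  assumes ori: "orientation G arev Ep"
    and \<nu>: "distribution ends \<nu>" "\<nu> (boundary T arevT) = 0"
    and fibre: "\<And>d e. d \<in> arcs T \<Longrightarrow> e \<in> arcs T \<Longrightarrow> pE d = pE e \<Longrightarrow> \<nu> (cyl d) = \<nu> (cyl e)"
  obtains c where "c \<in> carrier (H1 G Ep)" "\<And>d. d \<in> arcs T \<Longrightarrow> flow_of arev Ep c (pE d) = \<nu> (cyl d)"
proof -
  have flow: "flow (\<lambda>d. \<nu> (cyl d))" using \<nu> by (rule distribution_imp_flow)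
  have Ep: "Ep \<subseteq> arcs G" "finite Ep"
    using ori finite_subset[of Ep "arcs G"] G.finite_arcs unfolding orientation_def by auto
  have "\<exists>d. d \<in> arcs T \<and> pE d = a" if "a \<in> arcs G" for a
    using arc_lift_exists[OF that] by blast
  then obtain l where l: "\<And>a. a \<in> arcs G \<Longrightarrow> l a \<in> arcs T \<and> pE (l a) = a"
    by metis
  define c where "c = (\<Sum>a\<in>Ep. Poly_Mapping.single a (\<nu> (cyl (l a))))"
  have lookup: "Poly_Mapping.lookup c a = (if a \<in> Ep then \<nu> (cyl (l a)) else 0)" for a
    using Ep(2) by (simp add: c_def lookup_sum lookup_single when_def)
  then have keys: "Poly_Mapping.keys c \<subseteq> Ep" by (auto simp: in_keys_iff split: if_splits)
  have on_arcs: "flow_of arev Ep c (pE d) = \<nu> (cyl d)" if d: "d \<in> arcs T" for d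
  proof -
    have pos: "flow_of arev Ep c (pE e) = \<nu> (cyl e)" if e: "e \<in> arcs T" "pE e \<in> Ep" for e
    proof -
      have "\<nu> (cyl (l (pE e))) = \<nu> (cyl e)" using e l[OF pE_arc[OF e(1)]] by (intro fibre) auto
      with e show ?thesis by (simp add: flow_of_def lookup)
    qed
    show ?thesis
    proof (cases "pE d \<in> Ep")
      case False
      then have "arev (pE d) \<in> Ep"
        using ori pE_arc[OF d] unfolding orientation_def by (metis G.arev_arev UnE imageE)
      then have "flow_of arev Ep c (pE (arevT d)) = \<nu> (cyl (arevT d))"
        using d by (intro pos) (auto simp: pE_arev)
      with flow d ori show ?thesis
        by (simp add: flow_def pE_arev G.flow_of_arev pE_arc)
    qed (use pos d in blast)
  qed
  have "(\<Sum>a\<in>out_arcs G v. flow_of arev Ep c a) = 0" if "v \<in> verts G" for v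
  proof -
    obtain x where x: "x \<in> verts T" "pV x = v"
      using \<open>v \<in> verts G\<close> unfolding pV_image[symmetric] by (rule imageE) simp
    have "(\<Sum>a\<in>out_arcs G v. flow_of arev Ep c a) = (\<Sum>d\<in>out_arcs T x. flow_of arev Ep c (pE d))"
      using sum.reindex_bij_betw[OF pE_bij[OF x(1)], of "flow_of arev Ep c"] x(2) by simp
    also have "\<dots> = (\<Sum>d\<in>out_arcs T x. \<nu> (cyl d))" by (intro sum.cong) (auto simp: on_arcs)
    also have "\<dots> = 0" using flow x(1) by (simp add: flow_def)
    finally show ?thesis .
  qed
  with keys have "c \<in> carrier (H1 G Ep)"
    unfolding G.in_H1_iff[OF G.fin_digraph ori] by blast
  then show thesis using on_arcs by (rule that)
qed

abbreviation D0 :: "'x \<Rightarrow> ((nat \<Rightarrow> 'd) set set \<Rightarrow> 'm::ab_group_add) monoid" where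
  "D0 x \<equiv> invariant_distributions0 (fundamental_group G arev (pV x)) (group_action x) ends"

lemma in_D0_iff:
  assumes "x \<in> verts T"
  shows "\<nu> \<in> carrier (D0 x) \<longleftrightarrow>
    distribution ends \<nu> \<and> \<nu> (boundary T arevT) = 0 \<and>
    (\<forall>d\<in>arcs T. \<forall>e\<in>arcs T. pE d = pE e \<longrightarrow> \<nu> (cyl d) = \<nu> (cyl e))"
  using invariant_iff[OF assms, of \<nu>]
  by (auto simp: invariant_distributions0_def invariant_distributions_def topspace_ends)

text \<open>
  Additivity and surjectivity hold because distributions that agree on cylinders are equal;
  injectivity because every positive arc has a lift, whose cylinder recovers the coefficient.
\<close>

theorem H1_iso_D0:
  assumes ori: "orientation G arev Ep" and x: "x \<in> verts T"
  shows "(\<lambda>c. flow_distribution x (\<lambda>d. flow_of arev Ep c (pE d))) \<in>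
    iso (H1 G Ep :: ('e \<Rightarrow>\<^sub>0 'm::ab_group_add) monoid) (D0 x)"
proof -
  let ?\<Phi> = "\<lambda>c :: 'e \<Rightarrow>\<^sub>0 'm. flow_distribution x (\<lambda>d. flow_of arev Ep c (pE d))"
  have dist: "distribution ends (?\<Phi> c)" and total: "?\<Phi> c (boundary T arevT) = 0"
    and cyl: "\<And>d. d \<in> arcs T \<Longrightarrow> ?\<Phi> c (cyl d) = flow_of arev Ep c (pE d)"
    if "c \<in> carrier (H1 G Ep)" for c
    using flow_pullback[OF ori that]
    by (auto intro: distribution_flow_distribution flow_distribution_total[OF _ x]
        flow_distribution_cyl[OF _ x])
  have closed: "c + c' \<in> carrier (H1 G Ep)"
    if "c \<in> carrier (H1 G Ep)" "c' \<in> carrier (H1 G Ep)" for c c' :: "'e \<Rightarrow>\<^sub>0 'm"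
    using that Poly_Mapping.keys_add[of c c']
    by (auto simp: G.in_H1_iff[OF G.fin_digraph ori] flow_of_add sum.distrib)
  have add: "?\<Phi> (c + c') = (\<lambda>U. ?\<Phi> c U + ?\<Phi> c' U)"
    if c: "c \<in> carrier (H1 G Ep)" "c' \<in> carrier (H1 G Ep)" for c c'
  proof (rule distribution_eqI)
    show "distribution ends (\<lambda>U. ?\<Phi> c U + ?\<Phi> c' U)"
      using dist[OF c(1)] dist[OF c(2)] by (auto simp: distribution_def)
    show "distribution ends (?\<Phi> (c + c'))" by (rule dist[OF closed[OF c]])
    fix d assume d: "d \<in> arcs T"
    show "?\<Phi> (c + c') (cyl d) = ?\<Phi> c (cyl d) + ?\<Phi> c' (cyl d)"
      unfolding cyl[OF closed[OF c] d] cyl[OF c(1) d] cyl[OF c(2) d] by (rule flow_of_add)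
  qed
  have mem: "?\<Phi> c \<in> carrier (D0 x)" if "c \<in> carrier (H1 G Ep)" for c
    using that by (auto simp: in_D0_iff[OF x] dist total cyl)
  have "inj_on ?\<Phi> (carrier (H1 G Ep))"
  proof (rule inj_onI)
    fix c c' assume c: "c \<in> carrier (H1 G Ep)" "c' \<in> carrier (H1 G Ep)" and eq: "?\<Phi> c = ?\<Phi> c'"
    show "c = c'"
    proof (rule poly_mapping_eqI)
      fix a
      show "Poly_Mapping.lookup c a = Poly_Mapping.lookup c' a"
      proof (cases "a \<in> Ep")
        case True
        then have "a \<in> arcs G" using ori unfolding orientation_def by blast
        then obtain d where d: "d \<in> arcs T" "pE d = a" by (rule arc_lift_exists)
        with cyl[OF c(1) d(1)] cyl[OF c(2) d(1)] eq True show ?thesis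
          by (simp add: flow_of_def)
      next
        case False
        then have "a \<notin> Poly_Mapping.keys c" "a \<notin> Poly_Mapping.keys c'"
          using c G.in_H1_iff[OF G.fin_digraph ori] by blast+
        then show ?thesis by (simp add: in_keys_iff)
      qed
    qed
  qed
  moreover have "carrier (D0 x) \<subseteq> ?\<Phi> ` carrier (H1 G Ep)"
  proof
    fix \<nu> :: "(nat \<Rightarrow> 'd) set set \<Rightarrow> 'm" assume "\<nu> \<in> carrier (D0 x)"
    then have \<nu>: "distribution ends \<nu>" "\<nu> (boundary T arevT) = 0"
      "\<And>d e. d \<in> arcs T \<Longrightarrow> e \<in> arcs T \<Longrightarrow> pE d = pE e \<Longrightarrow> \<nu> (cyl d) = \<nu> (cyl e)"
      unfolding in_D0_iff[OF x] by blast+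
    then obtain c where c: "c \<in> carrier (H1 G Ep)"
        "\<And>d. d \<in> arcs T \<Longrightarrow> flow_of arev Ep c (pE d) = \<nu> (cyl d)"
      using cycle_of_distribution[OF ori] by blast
    then have "?\<Phi> c = \<nu>" by (intro distribution_eqI dist \<nu>(1)) (auto simp: cyl)
    with c(1) show "\<nu> \<in> ?\<Phi> ` carrier (H1 G Ep)" by blast
  qed
  ultimately have "bij_betw ?\<Phi> (carrier (H1 G Ep)) (carrier (D0 x))"
    using mem by (auto simp: bij_betw_def)
  moreover have "?\<Phi> \<in> hom (H1 G Ep) (D0 x)"
    using mem add
    by (intro homI) (auto simp: H1_def formal_sums_def invariant_distributions0_def
        invariant_distributions_def)
  ultimately show ?thesis by (simp add: iso_def)
qed

end

theorem theorem1p1: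
  fixes G :: "('v, 'e) pre_digraph" and arev :: "'e \<Rightarrow> 'e" and Ep :: "'e set"
    and \<Delta> :: "('x, 'd) pre_digraph" and arev\<Delta> :: "'d \<Rightarrow> 'd"
    and pV :: "'x \<Rightarrow> 'v" and pE :: "'d \<Rightarrow> 'e" and x0 :: 'x
  assumes "bidirected_digraph G arev" and "fin_digraph G" and "Digraph_Component.connected G"
    and "orientation G arev Ep"
    and "universal_covering_tree G arev \<Delta> arev\<Delta> pV pE"
    and "x0 \<in> verts \<Delta>"
  shows "(H1 G Ep :: ('e \<Rightarrow>\<^sub>0 'm::ab_group_add) monoid) \<cong>
    (invariant_distributions0 (fundamental_group G arev (pV x0))
      (boundary_action \<Delta> arev\<Delta> pV pE x0) (boundary_topology \<Delta> arev\<Delta>)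
      :: ((nat \<Rightarrow> 'd) set set \<Rightarrow> 'm) monoid)"
proof -
  have "reversal_tree \<Delta> arev\<Delta>" "covering G arev \<Delta> arev\<Delta> pV pE"
    using assms(5) by (auto simp: universal_covering_tree_def)
  moreover from this have "bidirected_digraph \<Delta> arev\<Delta>" by (simp add: reversal_tree_def)
  ultimately interpret universal_cover G arev \<Delta> arev\<Delta> pV pE
    using assms(1,2)
    by (intro universal_cover.intro universal_cover_axioms.intro
        reversal_tree_digraph.intro reversal_tree_digraph_axioms.intro)
  show ?thesis
    using H1_iso_D0[OF assms(4,6)] unfolding is_iso_def by blast
qed

end
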